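(* Let $\varepsilon>0$. Suppose that $F(t,x,v)=\eta(t)\varphi(x)\,v$, where $\varphi\in L^2(\mathbb R^N)$ is nonnegative and $\eta\in L^1_{loc}(0,+\infty)$ is nonnegative and such that $\eta\in L^\infty(0,T)$ for every $T>0$. Let $w_1\in H$ be nonnegative, let $w_0\in H$ and suppose that $\int_{\mathbb R^N}\varphi(x)w_0(x)\,dx>0$. Assume that $\eta$ is not Laplace transformable, i.e., $\int_0^{+\infty}e^{-t/\delta}\eta(t)\,dt=+\infty$ for every $\delta>0$. Then $\mathcal J_\varepsilon$ is unbounded from below over $\mathcal U^0_\varepsilon$; that is, for every $M>0$ there is $u\in\mathcal U^0_\varepsilon$ for which $\mathcal J_\varepsilon(u)$ is well defined and $\mathcal J_\varepsilon(u)<-M$.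
   Context: Fix an integer $N\ge1$ and $r>1$. A prime denotes the derivative in time $t$; $\nabla$ is the gradient in $x\in\mathbb R^N$. $H:=H^1(\mathbb R^N)\cap L^r(\mathbb R^N)$. For $v\in H$, $W(v):=\frac12\|\nabla v\|^2_{L^2(\mathbb R^N)}+\frac1r\|v\|^r_{L^r(\mathbb R^N)}$, with $W(v):=+\infty$ for $v\in L^2(\mathbb R^N)\setminus H$. $H^2_{loc}([0,+\infty);L^2(\mathbb R^N)):=\bigcap_{T>0}H^2((0,T);L^2(\mathbb R^N))$; $\mathcal U:=\{u\in H^2_{loc}([0,+\infty);L^2(\mathbb R^N)):\int_0^{+\infty}e^{-t}\|u''(t,\cdot)\|^2_{L^2(\mathbb R^N)}\,dt<+\infty\}$; $\mathcal U^0_\varepsilon:=\{u\in\mathcal U: u(0,\cdot)=w_0(\cdot),\ u'(0,\cdot)=\varepsilon w_1(\cdot)\}$. $\Phi_\varepsilon(u):=\int_0^{+\infty}e^{-t}\int_{\mathbb R^N}F(\varepsilon t,x,u(t,x))\,dx\,dt$ and $$\mathcal J_\varepsilon(u):=\int_0^{+\infty}e^{-t}\Big\{\frac1{2\varepsilon^2}\|u''(t,\cdot)\|^2_{L^2(\mathbb R^N)}+W(u(t,\cdot))\Big\}dt-\Phi_\varepsilon(u),$$ which is well defined at least for those $u\in\mathcal U^0_\varepsilon$ for which the integral defining $\Phi_\varepsilon(u)$ is absolutely convergent. *)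

theory Defs
  imports "HOL-Analysis.Analysis"
begin

(* Elements of Lebesgue, Sobolev and Bochner spaces are represented by Borel measurable
   functions; all notions below are invariant under modification on null sets. *)

section \<open>Test functions\<close>

primrec Ck :: "nat \<Rightarrow> ('a::euclidean_space \<Rightarrow> real) \<Rightarrow> bool" where
  "Ck 0 f \<longleftrightarrow> continuous_on UNIV f"
| "Ck (Suc k) f \<longleftrightarrow> (\<forall>x. f differentiable (at x)) \<and>
     (\<forall>b\<in>Basis. Ck k (\<lambda>x. frechet_derivative f (at x) b))"

definition test_functions :: "'a::euclidean_space set \<Rightarrow> ('a \<Rightarrow> real) set" where
  "test_functions S = {\<psi>. (\<forall>k. Ck k \<psi>) \<and> (\<exists>K. compact K \<and> K \<subseteq> S \<and> (\<forall>x. x \<notin> K \<longrightarrow> \<psi> x = 0))}"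

section \<open>Lebesgue spaces and the energy\<close>

definition Lp_space :: "real \<Rightarrow> ('a::euclidean_space \<Rightarrow> 'b::euclidean_space) set" where
  "Lp_space p = {f. f \<in> borel_measurable lborel \<and> integrable lborel (\<lambda>x. norm (f x) powr p)}"

definition Lp_norm :: "real \<Rightarrow> ('a::euclidean_space \<Rightarrow> 'b::euclidean_space) \<Rightarrow> real" where
  "Lp_norm p f = (\<integral>x. norm (f x) powr p \<partial>lborel) powr (1 / p)"

definition is_weak_gradient :: "('a::euclidean_space \<Rightarrow> real) \<Rightarrow> ('a \<Rightarrow> 'a) \<Rightarrow> bool" where
  "is_weak_gradient f g \<longleftrightarrow> (\<forall>\<psi>\<in>test_functions UNIV. \<forall>b\<in>Basis.
     (\<integral>x. f x * frechet_derivative \<psi> (at x) b \<partial>lborel) = - (\<integral>x. (g x \<bullet> b) * \<psi> x \<partial>lborel))"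

definition H1_space :: "('a::euclidean_space \<Rightarrow> real) set" where
  "H1_space = {f \<in> Lp_space 2. \<exists>g\<in>Lp_space 2. is_weak_gradient f g}"

(* The choice is immaterial: a weak gradient is unique up to null sets. *)
definition weak_gradient :: "('a::euclidean_space \<Rightarrow> real) \<Rightarrow> 'a \<Rightarrow> 'a" where
  "weak_gradient f = (SOME g. g \<in> Lp_space 2 \<and> is_weak_gradient f g)"

definition H_space :: "real \<Rightarrow> ('a::euclidean_space \<Rightarrow> real) set" where
  "H_space r = H1_space \<inter> Lp_space r"

definition W :: "real \<Rightarrow> ('a::euclidean_space \<Rightarrow> real) \<Rightarrow> ennreal" where
  "W r v = (if v \<in> H_space r
     then ennreal (1 / 2 * (Lp_norm 2 (weak_gradient v))\<^sup>2 + 1 / r * Lp_norm r v powr r)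
     else \<infinity>)"

section \<open>Sobolev spaces in time with values in the Lebesgue space of square integrable functions\<close>

(* L^2(I; L^2(R^N)). An element is represented by a function of (t, x) that is jointly
   measurable on I x R^N. *)
definition L2_L2 :: "real set \<Rightarrow> (real \<Rightarrow> 'a::euclidean_space \<Rightarrow> real) set" where
  "L2_L2 I = {u. set_borel_measurable (lborel \<Otimes>\<^sub>M lborel) (I \<times> UNIV) (\<lambda>(t, x). u t x) \<and>
     (AE t in lborel. t \<in> I \<longrightarrow> u t \<in> Lp_space 2) \<and>
     (\<integral>\<^sup>+t\<in>I. ennreal ((Lp_norm 2 (u t))\<^sup>2) \<partial>lborel) < \<infinity>}"

(* Equality in L^2(R^N) of the Bochner integrals of \<psi>' u and - \<psi> v over I; by joint
   measurability these integrals are computed pointwise for almost every x. *)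
definition is_weak_time_deriv ::
    "real set \<Rightarrow> (real \<Rightarrow> 'a::euclidean_space \<Rightarrow> real) \<Rightarrow> (real \<Rightarrow> 'a \<Rightarrow> real) \<Rightarrow> bool" where
  "is_weak_time_deriv I u v \<longleftrightarrow> (\<forall>\<psi>\<in>test_functions I. AE x in lborel.
     (LINT t:I|lborel. deriv \<psi> t * u t x) = - (LINT t:I|lborel. \<psi> t * v t x))"

definition H2_L2 :: "real set \<Rightarrow> (real \<Rightarrow> 'a::euclidean_space \<Rightarrow> real) set" where
  "H2_L2 I = {u \<in> L2_L2 I. \<exists>v\<in>L2_L2 I. \<exists>z\<in>L2_L2 I.
     is_weak_time_deriv I u v \<and> is_weak_time_deriv I v z}"

definition H2_loc :: "(real \<Rightarrow> 'a::euclidean_space \<Rightarrow> real) set" where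
  "H2_loc = (\<Inter>T\<in>{0<..}. H2_L2 {0<..<T})"

(* Weak time derivative on (0, \<infinity>), again unique up to null sets. *)
definition time_deriv :: "(real \<Rightarrow> 'a::euclidean_space \<Rightarrow> real) \<Rightarrow> real \<Rightarrow> 'a \<Rightarrow> real" where
  "time_deriv u = (SOME v. (\<forall>T>0. v \<in> L2_L2 {0<..<T}) \<and> is_weak_time_deriv {0<..} u v)"

(* u(0) = w, where u(0) is the value at 0 of the representative c of u that is continuous
   from [0, \<infinity>) to L^2(R^N). *)
definition has_initial_value ::
    "(real \<Rightarrow> 'a::euclidean_space \<Rightarrow> real) \<Rightarrow> ('a \<Rightarrow> real) \<Rightarrow> bool" where
  "has_initial_value u w \<longleftrightarrow> (\<exists>c. (\<forall>t\<ge>0. c t \<in> Lp_space 2) \<and>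
     (\<forall>s\<ge>0. ((\<lambda>t. Lp_norm 2 (\<lambda>x. c t x - c s x)) \<longlongrightarrow> 0) (at s within {0..})) \<and>
     (AE t in lborel. 0 < t \<longrightarrow> (AE x in lborel. c t x = u t x)) \<and>
     (AE x in lborel. c 0 x = w x))"

section \<open>The functional and its domain\<close>

definition U_space :: "(real \<Rightarrow> 'a::euclidean_space \<Rightarrow> real) set" where
  "U_space = {u \<in> H2_loc.
     (\<integral>\<^sup>+t\<in>{0<..}. ennreal (exp (- t) * (Lp_norm 2 (time_deriv (time_deriv u) t))\<^sup>2) \<partial>lborel) < \<infinity>}"

definition U0_space ::
    "real \<Rightarrow> ('a::euclidean_space \<Rightarrow> real) \<Rightarrow> ('a \<Rightarrow> real) \<Rightarrow> (real \<Rightarrow> 'a \<Rightarrow> real) set" where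
  "U0_space \<epsilon> w0 w1 = {u \<in> U_space. has_initial_value u w0 \<and>
     has_initial_value (time_deriv u) (\<lambda>x. \<epsilon> * w1 x)}"

definition Phi ::
    "real \<Rightarrow> (real \<Rightarrow> 'a::euclidean_space \<Rightarrow> real \<Rightarrow> real) \<Rightarrow> (real \<Rightarrow> 'a \<Rightarrow> real) \<Rightarrow> real" where
  "Phi \<epsilon> F u = (LINT t:{0<..}|lborel. exp (- t) * (LINT x|lborel. F (\<epsilon> * t) x (u t x)))"

definition Phi_abs_convergent ::
    "real \<Rightarrow> (real \<Rightarrow> 'a::euclidean_space \<Rightarrow> real \<Rightarrow> real) \<Rightarrow> (real \<Rightarrow> 'a \<Rightarrow> real) \<Rightarrow> bool" where
  "Phi_abs_convergent \<epsilon> F u \<longleftrightarrow> set_integrable (lborel \<Otimes>\<^sub>M lborel) ({0<..} \<times> UNIV)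
     (\<lambda>(t, x). exp (- t) * F (\<epsilon> * t) x (u t x))"

(* Meaningful when Phi_abs_convergent \<epsilon> F u holds; it may then still take the value \<infinity>. *)
definition J ::
    "real \<Rightarrow> real \<Rightarrow> (real \<Rightarrow> 'a::euclidean_space \<Rightarrow> real \<Rightarrow> real) \<Rightarrow> (real \<Rightarrow> 'a \<Rightarrow> real) \<Rightarrow> ereal" where
  "J r \<epsilon> F u = enn2ereal (\<integral>\<^sup>+t\<in>{0<..}. ennreal (exp (- t)) *
       (ennreal (1 / (2 * \<epsilon>\<^sup>2) * (Lp_norm 2 (time_deriv (time_deriv u) t))\<^sup>2) + W r (u t)) \<partial>lborel)
     - ereal (Phi \<epsilon> F u)"

section \<open>Conditions on the time coefficient of the forcing term\<close>

definition L1_loc_pos :: "(real \<Rightarrow> real) set" where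
  "L1_loc_pos = {\<eta>. \<forall>K. compact K \<and> K \<subseteq> {0<..} \<longrightarrow> set_integrable lborel K \<eta>}"

definition Linf_on :: "real set \<Rightarrow> (real \<Rightarrow> real) set" where
  "Linf_on I = {\<eta>. set_borel_measurable lborel I \<eta> \<and>
     (\<exists>C. AE t in lborel. t \<in> I \<longrightarrow> \<bar>\<eta> t\<bar> \<le> C)}"

end

theory Submission
  imports Defs
begin

text \<open>
  Competitors of the form \<open>u(t, x) = a(t) w0(x) + b(t) w1(x)\<close> suffice. Let \<open>a\<close> be \<open>cosh (\<alpha> t)\<close> and \<open>b\<close> be
  \<open>\<epsilon> t\<close>, both multiplied by a twice continuously differentiable cutoff that switches them off between
  \<open>t = T\<close> and \<open>t = T + 1\<close>; these profiles have the required values and slopes at \<open>t = 0\<close>. Their sizes and those of their second derivatives are at most \<open>K exp (\<alpha> t)\<close> with \<open>K\<close> independent of \<open>T\<close>. If \<open>2 \<alpha> < 1\<close> and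
  \<open>r \<alpha> < 1\<close>, the weight \<open>exp (- t)\<close> absorbs the squares and the \<open>r\<close>-th powers, so the kinetic
  and potential parts of the functional stay below a constant that does not depend on \<open>T\<close>
  (\<open>two_mode_energy_bound\<close>, \<open>cut_off_profile\<close>).

  The forcing term is finite for every \<open>T\<close>, because \<open>\<eta>\<close> is bounded on bounded intervals and \<open>u\<close> vanishes
  after \<open>T + 1\<close>. The sign conditions give it the lower bound
  \<open>1/2 (\<integral> \<phi> w0) \<integral>\<close> over \<open>(0, T)\<close> of \<open>exp (- (1 - \<alpha>) t) \<eta> (\<epsilon> t)\<close>. As \<open>T\<close> grows, this
  exhausts a Laplace integral of \<open>\<eta>\<close>, which diverges (\<open>forcing_work_unbounded\<close>). Hence the functional
  tends to minus infinity along this family.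

  What remains is to show that the weak derivatives of \<open>u\<close>, in space and in time, are the expected ones.
  Since they are defined by choice, this needs uniqueness almost everywhere, which rests on the
  fundamental lemma of the calculus of variations (\<open>fundamental_lemma\<close>). It is proved for a countable family of
  test functions, because for time derivatives the exceptional null set in space may depend on the test function.
\<close>

section \<open>Smooth bump functions\<close>

lemma Ck_SucI:
  assumes "\<And>x. (f has_derivative f' x) (at x)"
    and "\<And>b. b \<in> Basis \<Longrightarrow> Ck k (\<lambda>x. f' x b)"
  shows "Ck (Suc k) f"
proof -
  have "frechet_derivative f (at x) = f' x" for x
    using frechet_derivative_at[OF assms(1)] by simp
  then show ?thesis
    using assms by (auto simp: differentiable_def)
qed

lemma Ck_SucE:
  assumes "Ck (Suc k) f"
  shows "(f has_derivative frechet_derivative f (at x)) (at x)"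
    and "b \<in> Basis \<Longrightarrow> Ck k (\<lambda>x. frechet_derivative f (at x) b)"
  using assms by (auto simp: frechet_derivative_works)

lemma Ck_Suc_imp_Ck: "Ck (Suc k) f \<Longrightarrow> Ck k f"
proof (induction k arbitrary: f)
  case 0
  then show ?case
    by (auto intro!: continuous_at_imp_continuous_on differentiable_imp_continuous_within)
next
  case (Suc k)
  show ?case
    by (rule Ck_SucI[OF Ck_SucE(1)[OF Suc.prems]]) (rule Suc.IH, rule Ck_SucE(2)[OF Suc.prems])
qed

lemma Ck_const: "Ck k (\<lambda>x. c)"
proof (induction k arbitrary: c)
  case (Suc k)
  show ?case
    by (rule Ck_SucI[where f' = "\<lambda>x v. 0"]) (auto intro: Suc)
qed simp

lemma Ck_add: "Ck k f \<Longrightarrow> Ck k g \<Longrightarrow> Ck k (\<lambda>x. f x + g x)"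
proof (induction k arbitrary: f g)
  case (Suc k)
  note f = Ck_SucE[OF Suc.prems(1)] and g = Ck_SucE[OF Suc.prems(2)]
  show ?case
    by (rule Ck_SucI[OF has_derivative_add[OF f(1) g(1)]]) (intro Suc.IH f(2) g(2))
qed (auto intro!: continuous_intros)

lemma Ck_mult: "Ck k f \<Longrightarrow> Ck k g \<Longrightarrow> Ck k (\<lambda>x. f x * g x)"
proof (induction k arbitrary: f g)
  case (Suc k)
  note f = Ck_SucE[OF Suc.prems(1)] and g = Ck_SucE[OF Suc.prems(2)]
  show ?case
    by (rule Ck_SucI[OF has_derivative_mult[OF f(1) g(1)]])
       (intro Ck_add Suc.IH f(2) g(2) Ck_Suc_imp_Ck[OF Suc.prems(1)] Ck_Suc_imp_Ck[OF Suc.prems(2)])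
qed (auto intro!: continuous_intros)

lemma Ck_prod: "(\<And>i. i \<in> I \<Longrightarrow> Ck k (f i)) \<Longrightarrow> Ck k (\<lambda>x. \<Prod>i\<in>I. f i x)"
  by (induction I rule: infinite_finite_induct) (auto intro!: Ck_const Ck_mult)

text \<open>The powers of \<open>1/t\<close> are included because they make the family closed under
  differentiation, up to linear combinations; this is what the induction for smoothness needs.\<close>

definition flat_exp :: "nat \<Rightarrow> real \<Rightarrow> real" where
  "flat_exp j t = (if t > 0 then exp (- 1 / t) / t ^ j else 0)"

lemma flat_exp_nonneg: "flat_exp j t \<ge> 0"
  by (simp add: flat_exp_def)

lemma flat_exp_0_le_1: "flat_exp 0 t \<le> 1"
  by (simp add: flat_exp_def)

lemma flat_exp_eq_0: "t \<le> 0 \<Longrightarrow> flat_exp j t = 0"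
  by (simp add: flat_exp_def)

text \<open>Comparing \<open>exp (1/t)\<close> with one term of its power series gives a linear bound at the origin.\<close>

lemma flat_exp_le: "flat_exp j t \<le> fact (Suc j) * \<bar>t\<bar>"
proof (cases "t > 0")
  case True
  have "(1 / t) ^ Suc j / fact (Suc j) \<le> exp (1 / t)"
  proof -
    have "(1 / t) ^ Suc j / fact (Suc j) = (\<Sum>n\<in>{Suc j}. (1 / t) ^ n / fact n)" by simp
    also have "\<dots> \<le> (\<Sum>n. (1 / t) ^ n / fact n)"
      using True summable_exp[of "1 / t"]
      by (intro sum_le_suminf) (auto simp: field_simps)
    also have "\<dots> = exp (1 / t)"
      by (simp add: exp_def field_simps)
    finally show ?thesis .
  qed
  then have "1 \<le> exp (1 / t) * (fact (Suc j) * t ^ Suc j)"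
    using True by (simp add: power_one_over divide_simps mult_ac del: fact_Suc power_Suc)
  then have "1 / (exp (1 / t) * t ^ j) \<le> fact (Suc j) * t"
    using True by (subst pos_divide_le_eq) (auto simp: mult_ac)
  then show ?thesis
    using True by (simp add: flat_exp_def exp_minus divide_inverse mult_ac)
qed (auto simp: flat_exp_def mult_nonneg_nonpos simp del: fact_Suc)

lemma flat_exp_tendsto_0: "(flat_exp j \<longlongrightarrow> 0) (at 0)"
proof (rule tendsto_sandwich[of "\<lambda>_. 0" _ _ "\<lambda>t. fact (Suc j) * \<bar>t\<bar>"])
  show "((\<lambda>t::real. fact (Suc j) * \<bar>t\<bar>) \<longlongrightarrow> 0) (at 0)"
    by (auto intro!: tendsto_eq_intros)
qed (auto simp: flat_exp_nonneg flat_exp_le simp del: fact_Suc)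

lemma DERIV_flat_exp:
  "(flat_exp j has_real_derivative flat_exp (j + 2) t - j * flat_exp (Suc j) t) (at t)"
proof -
  consider "t > 0" | "t < 0" | "t = 0" by linarith
  then show ?thesis
  proof cases
    case 1
    have "((\<lambda>t. exp (- 1 / t) / t ^ j) has_real_derivative
        flat_exp (j + 2) t - j * flat_exp (Suc j) t) (at t)"
    proof -
      have "((\<lambda>t. exp (- 1 / t) / t ^ j) has_real_derivative
          (exp (- 1 / t) * (1 / (t * t)) * t ^ j - exp (- 1 / t) * (real j * t ^ (j - 1))) / (t ^ j * t ^ j)) (at t)"
        using 1 by (auto intro!: derivative_eq_intros)
      also have "(exp (- 1 / t) * (1 / (t * t)) * t ^ j - exp (- 1 / t) * (real j * t ^ (j - 1))) / (t ^ j * t ^ j)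
          = exp (- 1 / t) / t ^ (j + 2) - j * (exp (- 1 / t) / t ^ Suc j)"
      proof (cases j)
        case (Suc m)
        then show ?thesis using 1 by (simp add: diff_divide_distrib)
      qed (use 1 in simp)
      finally show ?thesis
        using 1 by (simp add: flat_exp_def)
    qed
    then show ?thesis
      by (rule DERIV_cong_ev[THEN iffD1, rotated -1])
         (use 1 in \<open>auto simp: flat_exp_def intro: eventually_mono[OF eventually_nhds_in_open[of "{0<..}"]]\<close>)
  next
    case 2
    have "((\<lambda>t. 0) has_real_derivative flat_exp (j + 2) t - j * flat_exp (Suc j) t) (at t)"
      using 2 by (simp add: flat_exp_def)
    then show ?thesis
      by (rule DERIV_cong_ev[THEN iffD1, rotated -1])
         (use 2 in \<open>auto simp: flat_exp_def intro: eventually_mono[OF eventually_nhds_in_open[of "{..<0}"]]\<close>)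
  next
    case 3
    have "(\<lambda>h. (flat_exp j (0 + h) - flat_exp j 0) / h) = flat_exp (Suc j)"
      by (auto simp: flat_exp_def fun_eq_iff field_simps)
    then show ?thesis
      using flat_exp_tendsto_0[of "Suc j"] 3 by (simp add: DERIV_def flat_exp_def)
  qed
qed

lemma Ck_flat_exp_affine: "Ck k (\<lambda>x. flat_exp j (l \<bullet> x + m))"
proof (induction k arbitrary: j)
  case 0
  have "continuous_on UNIV (flat_exp j)"
    by (auto intro!: continuous_at_imp_continuous_on DERIV_isCont[OF DERIV_flat_exp])
  then show ?case
    by (auto intro!: continuous_on_compose2[of UNIV "flat_exp j"] continuous_intros)
next
  case (Suc k)
  have *: "((\<lambda>x. flat_exp j (l \<bullet> x + m)) has_derivative
      (\<lambda>v. (l \<bullet> v) * (flat_exp (j + 2) (l \<bullet> x + m) + (- real j) * flat_exp (Suc j) (l \<bullet> x + m)))) (at x)"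
    for x
    by (rule has_derivative_eq_rhs[OF DERIV_compose_FDERIV[OF DERIV_flat_exp]])
       (auto intro!: derivative_eq_intros simp: fun_eq_iff algebra_simps)
  show ?case
    by (rule Ck_SucI[OF *]) (intro Ck_mult Ck_add Ck_const Suc)
qed

text \<open>At a point of the open box, as \<open>n\<close> grows, each factor \<open>exp (- 1 / (n c))\<close> with \<open>c > 0\<close> tends to 1;
  elsewhere some factor is 0. So the bumps converge to the indicator of the box without any normalisation.\<close>

definition box_bump :: "'a::euclidean_space \<Rightarrow> 'a \<Rightarrow> nat \<Rightarrow> 'a \<Rightarrow> real" where
  "box_bump a b n x =
    (\<Prod>i\<in>Basis. flat_exp 0 (n * (x \<bullet> i - a \<bullet> i)) * flat_exp 0 (n * (b \<bullet> i - x \<bullet> i)))"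

lemma box_bump_bounds: "0 \<le> box_bump a b n x" "box_bump a b n x \<le> 1"
  unfolding box_bump_def
  by (intro prod_nonneg ballI mult_nonneg_nonneg flat_exp_nonneg)
     (intro prod_le_1 conjI mult_nonneg_nonneg mult_le_one flat_exp_nonneg flat_exp_0_le_1)

lemma box_bump_outside: "x \<notin> box a b \<Longrightarrow> box_bump a b n x = 0"
  by (auto simp: box_bump_def box_def not_less intro!: flat_exp_eq_0 mult_nonneg_nonpos)

lemma box_bump_test_function:
  assumes "cbox a b \<subseteq> S"
  shows "box_bump a b n \<in> test_functions S"
proof -
  have "Ck k (\<lambda>x. flat_exp 0 (n * (x \<bullet> i - a \<bullet> i)))"
    and "Ck k (\<lambda>x. flat_exp 0 (n * (b \<bullet> i - x \<bullet> i)))" for k and i :: 'a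
    using Ck_flat_exp_affine[of k 0 "n *\<^sub>R i" "- n * (a \<bullet> i)"]
      Ck_flat_exp_affine[of k 0 "- n *\<^sub>R i" "n * (b \<bullet> i)"]
    by (simp_all add: algebra_simps inner_commute)
  then have "Ck k (box_bump a b n)" for k
    unfolding box_bump_def by (intro Ck_prod Ck_mult)
  moreover have "\<forall>x. x \<notin> cbox a b \<longrightarrow> box_bump a b n x = 0"
    using box_subset_cbox by (metis box_bump_outside subsetD)
  ultimately show ?thesis
    unfolding test_functions_def using assms by (auto intro!: exI[of _ "cbox a b"])
qed

lemma box_bump_tendsto: "(\<lambda>n. box_bump a b n x) \<longlonglongrightarrow> indicator (box a b) x"
proof (cases "x \<in> box a b")
  case True
  have lim: "(\<lambda>n. flat_exp 0 (real n * c)) \<longlonglongrightarrow> 1" if "c > 0" for c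
  proof -
    have "(\<lambda>n. exp (- (1 / c) * inverse (real n))) \<longlonglongrightarrow> exp (- (1 / c) * 0)"
      by (intro tendsto_intros lim_inverse_n)
    then have "(\<lambda>n. exp (- (1 / c) * inverse (real n))) \<longlonglongrightarrow> 1"
      by simp
    then show ?thesis
      by (rule Lim_transform_eventually)
         (use that in \<open>auto simp: flat_exp_def field_simps intro: eventually_mono[OF eventually_gt_at_top[of 0]]\<close>)
  qed
  have "(\<lambda>n. box_bump a b n x) \<longlonglongrightarrow> (\<Prod>i\<in>(Basis::'a set). 1 * 1)"
    unfolding box_bump_def using True by (intro tendsto_intros lim) (auto simp: box_def)
  with True show ?thesis by simp
qed (simp add: box_bump_outside)

section \<open>The fundamental lemma of the calculus of variations\<close>

definition rational_points :: "'a::euclidean_space set" where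
  "rational_points = {x. \<forall>i\<in>Basis. x \<bullet> i \<in> \<rat>}"

lemma countable_rational_points: "countable (rational_points :: 'a::euclidean_space set)"
proof -
  have "(rational_points :: 'a set) \<subseteq> (\<lambda>f. \<Sum>i\<in>Basis. f i *\<^sub>R i) ` (Basis \<rightarrow>\<^sub>E \<rat>)"
  proof
    fix x :: 'a assume "x \<in> rational_points"
    then show "x \<in> (\<lambda>f. \<Sum>i\<in>Basis. f i *\<^sub>R i) ` (Basis \<rightarrow>\<^sub>E \<rat>)"
      by (intro image_eqI[of _ _ "\<lambda>i\<in>Basis. x \<bullet> i"])
         (auto simp: rational_points_def euclidean_representation)
  qed
  then show ?thesis
    by (rule countable_subset) (intro countable_image countable_PiE finite_Basis countable_rat)
qed

text \<open>The closed box has to lie in \<open>S\<close>, so that the bumps on it are test functions on \<open>S\<close>.\<close>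

definition rational_boxes_in :: "'a::euclidean_space set \<Rightarrow> 'a set set" where
  "rational_boxes_in S = {box a b |a b. a \<in> rational_points \<and> b \<in> rational_points \<and> cbox a b \<subseteq> S}"

lemma rational_boxes_inI:
  "a \<in> rational_points \<Longrightarrow> b \<in> rational_points \<Longrightarrow> cbox a b \<subseteq> S \<Longrightarrow> box a b \<in> rational_boxes_in S"
  unfolding rational_boxes_in_def by blast

lemma rational_boxes_inE:
  assumes "B \<in> rational_boxes_in S"
  obtains a b where "B = box a b" "a \<in> rational_points" "b \<in> rational_points" "cbox a b \<subseteq> S"
  using assms unfolding rational_boxes_in_def by blast

lemma countable_rational_boxes_in: "countable (rational_boxes_in S)"
proof (rule countable_subset)
  show "rational_boxes_in S \<subseteq> (\<lambda>(a, b). box a b) ` (rational_points \<times> rational_points)"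
    by (auto simp: rational_boxes_in_def)
qed (intro countable_image countable_SIGMA countable_rational_points)

lemma Union_rational_boxes_in:
  fixes S :: "'a::euclidean_space set"
  assumes "open S"
  shows "\<Union>(rational_boxes_in S) = S"
proof
  show "\<Union>(rational_boxes_in S) \<subseteq> S"
    using box_subset_cbox by (fastforce simp: rational_boxes_in_def)
  show "S \<subseteq> \<Union>(rational_boxes_in S)"
  proof
    fix x assume "x \<in> S"
    then obtain e where e: "e > 0" "cball x e \<subseteq> S"
      using assms open_contains_cball by blast
    obtain a b where ab: "x \<in> box a b" "\<forall>i\<in>Basis. a \<bullet> i \<in> \<rat>" "\<forall>i\<in>Basis. b \<bullet> i \<in> \<rat>"
      "box a b \<subseteq> ball x e"
      using rational_boxes[OF e(1)] by metis
    have "cbox a b = closure (box a b)"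
      using ab(1) by (intro closure_box[symmetric]) auto
    also have "\<dots> \<subseteq> cball x e"
      using ab(4) by (metis closed_cball closure_minimal ball_subset_cball subset_trans)
    finally have "box a b \<in> rational_boxes_in S"
      using ab e by (intro rational_boxes_inI) (auto simp: rational_points_def)
    then show "x \<in> \<Union>(rational_boxes_in S)"
      using ab(1) by blast
  qed
qed

lemma sets_borel_eq_rational_boxes:
  "sets (borel :: 'a::euclidean_space measure) = sigma_sets UNIV (rational_boxes_in UNIV)"
proof
  have "sets (borel :: 'a measure) = sigma_sets UNIV {S. open S}"
    by (simp add: borel_def)
  also have "\<dots> \<subseteq> sigma_sets UNIV (rational_boxes_in UNIV)"
  proof (rule sigma_sets_mono, safe)
    fix S :: "'a set" assume "open S"
    have "\<Union>(rational_boxes_in S) \<in> sigma_sets UNIV (rational_boxes_in UNIV)"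
    proof (rule sigma_sets_UNION[OF countable_rational_boxes_in])
      fix B assume "B \<in> rational_boxes_in S"
      then show "B \<in> sigma_sets UNIV (rational_boxes_in UNIV)"
        by (intro sigma_sets.Basic) (auto simp: rational_boxes_in_def)
    qed
    then show "S \<in> sigma_sets UNIV (rational_boxes_in UNIV)"
      using Union_rational_boxes_in[OF \<open>open S\<close>] by simp
  qed
  finally show "sets (borel :: 'a measure) \<subseteq> sigma_sets UNIV (rational_boxes_in UNIV)" .
  have "rational_boxes_in UNIV \<subseteq> sets (borel :: 'a measure)"
    by (auto simp: rational_boxes_in_def)
  then show "sigma_sets UNIV (rational_boxes_in UNIV) \<subseteq> sets (borel :: 'a measure)"
    using sets.sigma_sets_subset[of "rational_boxes_in UNIV" "borel :: 'a measure"] by simp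
qed

lemma rational_boxes_in_Int:
  fixes A B :: "'a::euclidean_space set"
  assumes "A \<in> rational_boxes_in UNIV" "B \<in> rational_boxes_in S"
  shows "A \<inter> B \<in> insert {} (rational_boxes_in S)"
proof -
  obtain a b where A: "A = box a b" "a \<in> rational_points" "b \<in> rational_points"
    using assms(1) by (rule rational_boxes_inE)
  obtain c d where B: "B = box c d" "c \<in> rational_points" "d \<in> rational_points" "cbox c d \<subseteq> S"
    using assms(2) by (rule rational_boxes_inE)
  define l where "l = (\<Sum>i\<in>Basis. max (a \<bullet> i) (c \<bullet> i) *\<^sub>R i)"
  define u where "u = (\<Sum>i\<in>Basis. min (b \<bullet> i) (d \<bullet> i) *\<^sub>R i)"
  have lu: "l \<in> rational_points" "u \<in> rational_points"
    using A B by (auto simp: l_def u_def rational_points_def max_def min_def)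
  have eq: "A \<inter> B = box l u"
    unfolding A B l_def u_def by (rule box_Int_box)
  show ?thesis
  proof (cases "box l u = {}")
    case False
    then have "cbox l u = closure (box l u)" by (simp add: closure_box)
    also have "\<dots> \<subseteq> cbox c d"
      using eq B(1) box_subset_cbox[of c d] by (metis closed_cbox closure_minimal inf.cobounded2 subset_trans)
    finally show ?thesis
      unfolding eq using lu B(4) by (intro insertI2 rational_boxes_inI) auto
  qed (simp add: eq)
qed

definition rational_bumps :: "'a::euclidean_space set \<Rightarrow> ('a \<Rightarrow> real) set" where
  "rational_bumps S =
    {box_bump a b n |a b n. a \<in> rational_points \<and> b \<in> rational_points \<and> cbox a b \<subseteq> S}"

lemma countable_rational_bumps: "countable (rational_bumps S)"
proof (rule countable_subset)
  show "rational_bumps S \<subseteq> (\<lambda>(a, b, n). box_bump a b n) ` (rational_points \<times> rational_points \<times> UNIV)"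
    unfolding rational_bumps_def by force
qed (intro countable_image countable_SIGMA countable_rational_points, auto)

lemma rational_bumps_test_functions: "rational_bumps S \<subseteq> test_functions S"
  by (auto simp: rational_bumps_def intro: box_bump_test_function)

text \<open>Dominated convergence along the bumps shows that the integral of \<open>f\<close> over every rational box in \<open>S\<close>
  vanishes. Rational boxes are stable under intersection and generate the Borel sets, so the integral
  over every Borel subset of such a box vanishes, and \<open>f\<close> is zero almost everywhere there.
  Countably many of these boxes cover \<open>S\<close>.\<close>

lemma fundamental_lemma:
  fixes f :: "'a::euclidean_space \<Rightarrow> real"
  assumes "open S"
    and int: "\<And>a b. cbox a b \<subseteq> S \<Longrightarrow> set_integrable lborel (cbox a b) f"
    and zero: "\<And>\<psi>. \<psi> \<in> rational_bumps S \<Longrightarrow> (\<integral>x. \<psi> x * f x \<partial>lborel) = 0"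
  shows "AE x in lborel. x \<in> S \<longrightarrow> f x = 0"
proof -
  have box0: "(LINT x:B|lborel. f x) = 0" if "B \<in> insert {} (rational_boxes_in S)" for B
  proof (cases "B = {}")
    case False
    with that have "B \<in> rational_boxes_in S" by simp
    then obtain a b where B: "B = box a b"
      and ab: "a \<in> rational_points" "b \<in> rational_points" "cbox a b \<subseteq> S"
      by (rule rational_boxes_inE)
    define g where "g x = indicator (cbox a b) x * f x" for x
    have g: "integrable lborel g"
      using int[OF ab(3)] by (simp add: set_integrable_def g_def[abs_def])
    have eq: "box_bump a b n x * g x = box_bump a b n x * f x" for n x
      using box_bump_outside[of x a b n] box_subset_cbox[of a b] by (auto simp: g_def indicator_def)
    have meas: "box_bump a b n \<in> borel_measurable borel" for n
      unfolding box_bump_def[abs_def] flat_exp_def by measurable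
    have "(\<lambda>n. \<integral>x. box_bump a b n x * g x \<partial>lborel) \<longlonglongrightarrow> (\<integral>x. indicator (box a b) x * g x \<partial>lborel)"
    proof (rule integral_dominated_convergence[where w = "\<lambda>x. \<bar>g x\<bar>"])
      show "AE x in lborel. norm (box_bump a b n x * g x) \<le> \<bar>g x\<bar>" for n
        using box_bump_bounds[of a b n] by (auto simp: abs_mult intro!: mult_left_le_one_le)
      show "AE x in lborel. (\<lambda>n. box_bump a b n x * g x) \<longlonglongrightarrow> indicator (box a b) x * g x"
        by (intro AE_I2 tendsto_intros box_bump_tendsto)
    qed (use g meas in auto)
    moreover have "(\<integral>x. box_bump a b n x * g x \<partial>lborel) = 0" for n
      unfolding eq by (rule zero) (use ab in \<open>auto simp: rational_bumps_def\<close>)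
    ultimately have "(\<integral>x. indicator (box a b) x * g x \<partial>lborel) = 0"
      by (simp add: LIMSEQ_const_iff)
    moreover have "indicator (box a b) x * g x = indicator (box a b) x * f x" for x
      using box_subset_cbox[of a b] by (auto simp: g_def indicator_def)
    ultimately show ?thesis
      by (simp add: B set_lebesgue_integral_def)
  qed (simp add: set_lebesgue_integral_def)
  have "AE x in lborel. x \<in> B \<longrightarrow> f x = 0" if B: "B \<in> rational_boxes_in S" for B
  proof -
    define g where "g x = indicator B x * f x" for x
    have "set_integrable lborel B f"
      using B box_subset_cbox by (auto simp: rational_boxes_in_def intro!: set_integrable_subset[OF int])
    then have g: "integrable lborel g"
      by (simp add: set_integrable_def g_def[abs_def])
    have g0: "(\<integral>x. g x \<partial>lborel) = 0"
      using box0[of B] B by (simp add: g_def set_lebesgue_integral_def)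
    have setg: "set_integrable lborel A g" if "A \<in> sets borel" for A
      unfolding set_integrable_def by (rule integrable_mult_indicator) (use g that in simp_all)
    let ?G = "rational_boxes_in UNIV \<union> {{}} :: 'a set set"
    have stable: "Int_stable ?G"
      using rational_boxes_in_Int[of _ _ UNIV] by (auto simp: Int_stable_def)
    have gen: "A \<in> sigma_sets UNIV ?G" if "A \<in> sets borel" for A
      using that sigma_sets_mono'[of "rational_boxes_in UNIV" ?G]
      by (auto simp: sets_borel_eq_rational_boxes)
    have sets: "A \<in> sets borel" if "A \<in> sigma_sets UNIV ?G" for A
    proof -
      have "?G \<subseteq> sets borel"
        by (auto simp: rational_boxes_in_def)
      then show ?thesis
        using sets.sigma_sets_subset[of ?G borel] that by auto
    qed
    have Pow: "?G \<subseteq> Pow UNIV" by simp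
    have "(LINT x:A|lborel. g x) = 0" if "A \<in> sets borel" for A
      using stable Pow gen[OF that]
    proof (induction rule: sigma_sets_induct_disjoint)
      case (basic A)
      then have "A \<inter> B \<in> insert {} (rational_boxes_in S)"
        using rational_boxes_in_Int[OF _ B, of A] by auto
      from box0[OF this] show ?case
        by (simp add: g_def set_lebesgue_integral_def indicator_inter_arith mult_ac)
    next
      case (compl A)
      have "(LINT x:(UNIV - A)|lborel. g x) = (\<integral>x. g x - indicator A x * g x \<partial>lborel)"
        unfolding set_lebesgue_integral_def by (intro Bochner_Integration.integral_cong) (auto simp: indicator_def)
      also have "\<dots> = (\<integral>x. g x \<partial>lborel) - (LINT x:A|lborel. g x)"
        using setg[OF sets[OF compl(1)]] g
        by (simp add: set_lebesgue_integral_def set_integrable_def)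
      finally show ?case using compl g0 by simp
    next
      case (union F)
      have F: "F i \<in> sets borel" for i
        using union(2) by (intro sets) blast
      have "(LINT x:(\<Union>i. F i)|lborel. g x) = (\<Sum>i. LINT x:F i|lborel. g x)"
        using union(1) F by (intro lebesgue_integral_countable_add setg)
          (auto simp: disjoint_family_on_def)
      then show ?case using union by simp
    qed (simp add: set_lebesgue_integral_def)
    then have "AE x in lborel. g x = 0"
      by (intro sigma_finite_measure.density_zero[OF sigma_finite_lborel] g) auto
    then show ?thesis
      by eventually_elim (auto simp: g_def)
  qed
  then have "AE x in lborel. \<forall>B\<in>rational_boxes_in S. x \<in> B \<longrightarrow> f x = 0"
    by (subst AE_ball_countable[OF countable_rational_boxes_in]) auto
  then show ?thesis
    by (rule eventually_mono) (use Union_rational_boxes_in[OF \<open>open S\<close>] in fast)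
qed

section \<open>Lebesgue norms of linear combinations\<close>

lemma Lp_spaceD:
  assumes "f \<in> Lp_space p"
  shows "f \<in> borel_measurable borel" "integrable lborel (\<lambda>x. norm (f x) powr p)"
  using assms by (auto simp: Lp_space_def)

lemma Lp_norm_powr: "p > 0 \<Longrightarrow> Lp_norm p f powr p = (\<integral>x. norm (f x) powr p \<partial>lborel)"
  by (simp add: Lp_norm_def powr_powr)

lemma Lp_norm_2_sq: "(Lp_norm 2 f)\<^sup>2 = (\<integral>x. norm (f x) powr 2 \<partial>lborel)"
  using Lp_norm_powr[of 2 f] by (simp add: Lp_norm_def powr_numeral)

text \<open>A sum is at most twice its larger term; this is the origin of the factor \<open>2 powr p\<close>, and it covers all
  exponents \<open>p > 0\<close> at once.\<close>

lemma norm_lincomb_powr_le: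
  fixes x y :: "'a::real_normed_vector"
  assumes "p > 0"
  shows "norm (a *\<^sub>R x + b *\<^sub>R y) powr p
    \<le> 2 powr p * (\<bar>a\<bar> powr p * norm x powr p + \<bar>b\<bar> powr p * norm y powr p)"
proof -
  define M where "M = max (\<bar>a\<bar> * norm x) (\<bar>b\<bar> * norm y)"
  have "norm (a *\<^sub>R x + b *\<^sub>R y) \<le> \<bar>a\<bar> * norm x + \<bar>b\<bar> * norm y"
    using norm_triangle_ineq[of "a *\<^sub>R x" "b *\<^sub>R y"] by simp
  also have "\<dots> \<le> 2 * M"
    by (simp add: M_def)
  finally have "norm (a *\<^sub>R x + b *\<^sub>R y) powr p \<le> (2 * M) powr p"
    using assms by (intro powr_mono2) auto
  also have "\<dots> = 2 powr p * M powr p"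
    by (rule powr_mult)
  also have "M powr p \<le> \<bar>a\<bar> powr p * norm x powr p + \<bar>b\<bar> powr p * norm y powr p"
    by (auto simp: M_def max_def powr_mult)
  finally show ?thesis by simp
qed

lemma Lp_lincomb:
  fixes f g :: "'a::euclidean_space \<Rightarrow> 'b::euclidean_space"
  assumes "p > 0" and f: "f \<in> Lp_space p" and g: "g \<in> Lp_space p"
  shows "(\<lambda>x. a *\<^sub>R f x + b *\<^sub>R g x) \<in> Lp_space p"
    and "(\<integral>x. norm (a *\<^sub>R f x + b *\<^sub>R g x) powr p \<partial>lborel)
      \<le> 2 powr p * (\<bar>a\<bar> powr p * (\<integral>x. norm (f x) powr p \<partial>lborel)
        + \<bar>b\<bar> powr p * (\<integral>x. norm (g x) powr p \<partial>lborel))"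
proof -
  note [measurable] = Lp_spaceD(1)[OF f] Lp_spaceD(1)[OF g]
  note [simp] = Lp_spaceD(2)[OF f] Lp_spaceD(2)[OF g]
  have bd: "integrable lborel (\<lambda>x. 2 powr p * (\<bar>a\<bar> powr p * norm (f x) powr p + \<bar>b\<bar> powr p * norm (g x) powr p))"
    by simp
  have int: "integrable lborel (\<lambda>x. norm (a *\<^sub>R f x + b *\<^sub>R g x) powr p)"
    by (rule Bochner_Integration.integrable_bound[OF bd])
       (use norm_lincomb_powr_le[OF \<open>p > 0\<close>, of a _ b] in \<open>auto intro!: AE_I2\<close>)
  then show "(\<lambda>x. a *\<^sub>R f x + b *\<^sub>R g x) \<in> Lp_space p"
    by (simp add: Lp_space_def)
  have "(\<integral>x. norm (a *\<^sub>R f x + b *\<^sub>R g x) powr p \<partial>lborel)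
      \<le> (\<integral>x. 2 powr p * (\<bar>a\<bar> powr p * norm (f x) powr p + \<bar>b\<bar> powr p * norm (g x) powr p) \<partial>lborel)"
    by (intro integral_mono int bd norm_lincomb_powr_le[OF \<open>p > 0\<close>])
  then show "(\<integral>x. norm (a *\<^sub>R f x + b *\<^sub>R g x) powr p \<partial>lborel)
      \<le> 2 powr p * (\<bar>a\<bar> powr p * (\<integral>x. norm (f x) powr p \<partial>lborel)
        + \<bar>b\<bar> powr p * (\<integral>x. norm (g x) powr p \<partial>lborel))"
    by simp
qed

lemma L2_mult_integrable:
  fixes f g :: "'a::euclidean_space \<Rightarrow> real"
  assumes "f \<in> Lp_space 2" "g \<in> Lp_space 2"
  shows "integrable lborel (\<lambda>x. f x * g x)"
proof (rule Bochner_Integration.integrable_bound)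
  note fg = Lp_spaceD[OF assms(1)] Lp_spaceD[OF assms(2)]
  note [measurable] = fg(1,3)
  show "integrable lborel (\<lambda>x. norm (f x) powr 2 + norm (g x) powr 2)"
    using fg by simp
  have "\<bar>x * y\<bar> \<le> x\<^sup>2 + y\<^sup>2" for x y :: real
  proof -
    have "2 * (\<bar>x\<bar> * \<bar>y\<bar>) \<le> x\<^sup>2 + y\<^sup>2"
      using sum_squares_bound[of "\<bar>x\<bar>" "\<bar>y\<bar>"] by (simp add: mult.assoc)
    moreover have "0 \<le> \<bar>x\<bar> * \<bar>y\<bar>" by simp
    ultimately show ?thesis unfolding abs_mult by linarith
  qed
  then show "AE x in lborel. norm (f x * g x) \<le> norm (norm (f x) powr 2 + norm (g x) powr 2)"
    by (auto simp: powr_numeral)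
qed (use Lp_spaceD(1)[OF assms(1)] Lp_spaceD(1)[OF assms(2)] in simp)

lemma L2_inner_Basis:
  fixes g :: "'a::euclidean_space \<Rightarrow> 'b::euclidean_space"
  assumes "g \<in> Lp_space 2" "b \<in> Basis"
  shows "(\<lambda>x. g x \<bullet> b) \<in> Lp_space 2"
proof -
  note [measurable] = Lp_spaceD(1)[OF assms(1)]
  have "norm (g x \<bullet> b) powr 2 \<le> norm (g x) powr 2" for x
    using assms(2) by (intro powr_mono2) (auto simp: Basis_le_norm)
  then have "integrable lborel (\<lambda>x. norm (g x \<bullet> b) powr 2)"
    by (intro Bochner_Integration.integrable_bound[OF Lp_spaceD(2)[OF assms(1)]])
       auto
  then show ?thesis by (simp add: Lp_space_def)
qed

lemma L2_continuous_compact_support: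
  fixes f :: "'a::euclidean_space \<Rightarrow> real"
  assumes "continuous_on UNIV f" "compact K" "\<And>x. x \<notin> K \<Longrightarrow> f x = 0"
  shows "f \<in> Lp_space 2"
proof -
  have f[measurable]: "f \<in> borel_measurable borel"
    using assms(1) by (rule borel_measurable_continuous_onI)
  have "integrable lborel (\<lambda>x. indicator K x *\<^sub>R (norm (f x) powr 2))"
    by (intro borel_integrable_compact assms)
       (auto intro!: continuous_intros continuous_on_subset[OF assms(1)] simp: powr_numeral)
  also have "(\<lambda>x. indicator K x *\<^sub>R (norm (f x) powr 2)) = (\<lambda>x. norm (f x) powr 2)"
    using assms(3) by (auto simp: indicator_def fun_eq_iff)
  finally show ?thesis by (simp add: Lp_space_def)
qed

lemma test_functionsE:
  fixes \<psi> :: "'a::euclidean_space \<Rightarrow> real"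
  assumes "\<psi> \<in> test_functions S"
  obtains K where "compact K" "K \<subseteq> S" "\<And>x. x \<notin> K \<Longrightarrow> \<psi> x = 0"
    "\<And>x. (\<psi> has_derivative frechet_derivative \<psi> (at x)) (at x)"
    "\<And>x b. x \<notin> K \<Longrightarrow> frechet_derivative \<psi> (at x) b = 0"
    "continuous_on UNIV \<psi>" "\<And>b. b \<in> Basis \<Longrightarrow> continuous_on UNIV (\<lambda>x. frechet_derivative \<psi> (at x) b)"
proof -
  from assms obtain K where K: "compact K" "K \<subseteq> S" "\<And>x. x \<notin> K \<Longrightarrow> \<psi> x = 0" and C: "\<And>k. Ck k \<psi>"
    unfolding test_functions_def by blast
  have D: "(\<psi> has_derivative frechet_derivative \<psi> (at x)) (at x)" for x
    using C[of 1] by (auto simp: frechet_derivative_works)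
  have "frechet_derivative \<psi> (at x) b = 0" if "x \<notin> K" for x b
  proof -
    have "((\<lambda>x. 0) has_derivative frechet_derivative \<psi> (at x)) (at x)"
      by (rule has_derivative_transform_within_open[OF D, of "- K"])
         (use that K in \<open>auto intro: compact_imp_closed\<close>)
    then have "frechet_derivative \<psi> (at x) = (\<lambda>h. 0)"
      by (rule has_derivative_unique) simp
    then show ?thesis by simp
  qed
  with K D C[of 0] C[of 1] that show thesis by auto
qed

lemma L2_test_function:
  assumes "\<psi> \<in> test_functions S"
  shows "\<psi> \<in> Lp_space 2" "b \<in> Basis \<Longrightarrow> (\<lambda>x. frechet_derivative \<psi> (at x) b) \<in> Lp_space 2"
  using assms by (auto elim!: test_functionsE intro!: L2_continuous_compact_support)

section \<open>Weak gradients and the energy of a linear combination\<close>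

lemma is_weak_gradient_lincomb:
  assumes f: "f1 \<in> Lp_space 2" "f2 \<in> Lp_space 2" and g: "g1 \<in> Lp_space 2" "g2 \<in> Lp_space 2"
    and w: "is_weak_gradient f1 g1" "is_weak_gradient f2 g2"
  shows "is_weak_gradient (\<lambda>x. a * f1 x + c * f2 x) (\<lambda>x. a *\<^sub>R g1 x + c *\<^sub>R g2 x)"
  unfolding is_weak_gradient_def
proof (intro ballI)
  fix \<psi> :: "'a \<Rightarrow> real" and b :: 'a
  assume \<psi>: "\<psi> \<in> test_functions UNIV" and b: "b \<in> Basis"
  note [simp] = L2_mult_integrable[OF f(1) L2_test_function(2)[OF \<psi> b]]
    L2_mult_integrable[OF f(2) L2_test_function(2)[OF \<psi> b]]
    L2_mult_integrable[OF L2_inner_Basis[OF g(1) b] L2_test_function(1)[OF \<psi>]]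
    L2_mult_integrable[OF L2_inner_Basis[OF g(2) b] L2_test_function(1)[OF \<psi>]]
  have "(\<integral>x. (a * f1 x + c * f2 x) * frechet_derivative \<psi> (at x) b \<partial>lborel)
      = a * (\<integral>x. f1 x * frechet_derivative \<psi> (at x) b \<partial>lborel)
        + c * (\<integral>x. f2 x * frechet_derivative \<psi> (at x) b \<partial>lborel)"
    by (simp add: distrib_right mult.assoc)
  also have "\<dots> = - (a * (\<integral>x. (g1 x \<bullet> b) * \<psi> x \<partial>lborel) + c * (\<integral>x. (g2 x \<bullet> b) * \<psi> x \<partial>lborel))"
    using w \<psi> b by (simp add: is_weak_gradient_def)
  also have "\<dots> = - (\<integral>x. ((a *\<^sub>R g1 x + c *\<^sub>R g2 x) \<bullet> b) * \<psi> x \<partial>lborel)"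
    by (simp add: distrib_right inner_add_left mult.assoc)
  finally show "(\<integral>x. (a * f1 x + c * f2 x) * frechet_derivative \<psi> (at x) b \<partial>lborel)
      = - (\<integral>x. ((a *\<^sub>R g1 x + c *\<^sub>R g2 x) \<bullet> b) * \<psi> x \<partial>lborel)" .
qed

lemma is_weak_gradient_unique:
  fixes g1 g2 :: "'a::euclidean_space \<Rightarrow> 'a"
  assumes g: "g1 \<in> Lp_space 2" "g2 \<in> Lp_space 2"
    and w: "is_weak_gradient f g1" "is_weak_gradient f g2"
  shows "AE x in lborel. g1 x = g2 x"
proof -
  have "AE x in lborel. g1 x \<bullet> b - g2 x \<bullet> b = 0" if b: "b \<in> Basis" for b
  proof -
    note gb = L2_inner_Basis[OF g(1) b] L2_inner_Basis[OF g(2) b]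
    have "AE x in lborel. x \<in> UNIV \<longrightarrow> g1 x \<bullet> b - g2 x \<bullet> b = 0"
    proof (rule fundamental_lemma)
      fix u v :: 'a
      have "(indicator (cbox u v) :: 'a \<Rightarrow> real) \<in> Lp_space 2"
      proof -
        have "(\<lambda>x. norm (indicator (cbox u v) x :: real) powr 2) = indicator (cbox u v)"
          by (auto simp: indicator_def)
        then show ?thesis by (simp add: Lp_space_def emeasure_lborel_cbox_eq)
      qed
      from L2_mult_integrable[OF this gb(1)] L2_mult_integrable[OF this gb(2)]
      show "set_integrable lborel (cbox u v) (\<lambda>x. g1 x \<bullet> b - g2 x \<bullet> b)"
        by (simp add: set_integrable_def right_diff_distrib)
    next
      fix \<psi> :: "'a \<Rightarrow> real" assume "\<psi> \<in> rational_bumps UNIV"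
      then have \<psi>: "\<psi> \<in> test_functions UNIV"
        using rational_bumps_test_functions by blast
      note int = L2_mult_integrable[OF gb(1) L2_test_function(1)[OF \<psi>]]
        L2_mult_integrable[OF gb(2) L2_test_function(1)[OF \<psi>]]
      have "(\<integral>x. \<psi> x * (g1 x \<bullet> b - g2 x \<bullet> b) \<partial>lborel)
          = (\<integral>x. (g1 x \<bullet> b) * \<psi> x \<partial>lborel) - (\<integral>x. (g2 x \<bullet> b) * \<psi> x \<partial>lborel)"
        using int by (simp add: right_diff_distrib mult.commute)
      also have "\<dots> = 0"
        using w[unfolded is_weak_gradient_def, THEN bspec, OF \<psi>, THEN bspec, OF b] by simp
      finally show "(\<integral>x. \<psi> x * (g1 x \<bullet> b - g2 x \<bullet> b) \<partial>lborel) = 0" .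
    qed simp
    then show ?thesis by simp
  qed
  then have "AE x in lborel. \<forall>b\<in>Basis. g1 x \<bullet> b - g2 x \<bullet> b = 0"
    by (intro AE_finite_allI) auto
  then show ?thesis
    by (rule eventually_mono) (rule euclidean_eqI, simp)
qed

text \<open>The chosen weak gradient of a linear combination agrees almost everywhere with the linear
  combination of weak gradients, so the energy is controlled by the coefficients alone.\<close>

lemma W_lincomb_bound:
  fixes w0 w1 :: "'a::euclidean_space \<Rightarrow> real"
  assumes "r > 1" and w0: "w0 \<in> H_space r" and w1: "w1 \<in> H_space r"
  obtains C where "C \<ge> 0" and "\<And>a b. W r (\<lambda>x. a * w0 x + b * w1 x)
    \<le> ennreal (C * (\<bar>a\<bar> powr 2 + \<bar>b\<bar> powr 2 + \<bar>a\<bar> powr r + \<bar>b\<bar> powr r))"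
proof -
  obtain g0 g1 where g: "g0 \<in> Lp_space 2" "g1 \<in> Lp_space 2" "is_weak_gradient w0 g0" "is_weak_gradient w1 g1"
    using w0 w1 by (auto simp: H_space_def H1_space_def)
  have L: "w0 \<in> Lp_space 2" "w1 \<in> Lp_space 2" "w0 \<in> Lp_space r" "w1 \<in> Lp_space r"
    using w0 w1 by (auto simp: H_space_def H1_space_def)
  define I where "I p f = (\<integral>x. norm (f x) powr p \<partial>(lborel :: 'a measure))" for p and f :: "'a \<Rightarrow> 'a"
  define I' where "I' p f = (\<integral>x. norm (f x) powr p \<partial>(lborel :: 'a measure))" for p and f :: "'a \<Rightarrow> real"
  have I_nonneg: "I p f \<ge> 0" "I' p f' \<ge> 0" for p f f'
    by (auto simp: I_def I'_def)
  define C where "C = 2 * (I 2 g0 + I 2 g1) + 2 powr r / r * (I' r w0 + I' r w1)"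
  have "W r (\<lambda>x. a * w0 x + b * w1 x)
      \<le> ennreal (C * (\<bar>a\<bar> powr 2 + \<bar>b\<bar> powr 2 + \<bar>a\<bar> powr r + \<bar>b\<bar> powr r))" for a b
  proof -
    define v where "v x = a * w0 x + b * w1 x" for x
    define d where "d x = a *\<^sub>R g0 x + b *\<^sub>R g1 x" for x
    have d: "d \<in> Lp_space 2" and Id: "I 2 d \<le> 2 powr 2 * (\<bar>a\<bar> powr 2 * I 2 g0 + \<bar>b\<bar> powr 2 * I 2 g1)"
      using Lp_lincomb[of 2 g0 g1 a b] g unfolding I_def d_def[abs_def] by simp_all
    have vr: "v \<in> Lp_space r" and Iv: "I' r v \<le> 2 powr r * (\<bar>a\<bar> powr r * I' r w0 + \<bar>b\<bar> powr r * I' r w1)"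
      using Lp_lincomb[of r w0 w1 a b] L \<open>r > 1\<close> unfolding I'_def v_def[abs_def] by simp_all
    have v2: "v \<in> Lp_space 2"
      using Lp_lincomb(1)[of 2 w0 w1 a b] L unfolding v_def[abs_def] by simp
    have vd: "is_weak_gradient v d"
      unfolding v_def[abs_def] d_def[abs_def] by (intro is_weak_gradient_lincomb L g)
    have H: "v \<in> H_space r"
      using vr v2 vd d by (auto simp: H_space_def H1_space_def)
    have "weak_gradient v \<in> Lp_space 2 \<and> is_weak_gradient v (weak_gradient v)"
      unfolding weak_gradient_def by (rule someI[of _ d]) (use d vd in auto)
    then have wg: "weak_gradient v \<in> Lp_space 2" and "AE x in lborel. weak_gradient v x = d x"
      using is_weak_gradient_unique d vd by blast+
    then have "I 2 (weak_gradient v) = I 2 d"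
      unfolding I_def using Lp_spaceD(1)[OF wg] Lp_spaceD(1)[OF d]
      by (intro integral_cong_AE) auto
    then have "1 / 2 * (Lp_norm 2 (weak_gradient v))\<^sup>2 + 1 / r * Lp_norm r v powr r = I 2 d / 2 + I' r v / r"
      using \<open>r > 1\<close> by (simp add: Lp_norm_2_sq Lp_norm_powr I_def I'_def)
    also have "\<dots> \<le> 2 * (\<bar>a\<bar> powr 2 * I 2 g0 + \<bar>b\<bar> powr 2 * I 2 g1)
        + 2 powr r / r * (\<bar>a\<bar> powr r * I' r w0 + \<bar>b\<bar> powr r * I' r w1)"
      using Id Iv \<open>r > 1\<close> by (intro add_mono) (auto simp: divide_right_mono powr_numeral)
    also have "\<dots> \<le> C * (\<bar>a\<bar> powr 2 + \<bar>b\<bar> powr 2 + \<bar>a\<bar> powr r + \<bar>b\<bar> powr r)"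
    proof -
      define S where "S = \<bar>a\<bar> powr 2 + \<bar>b\<bar> powr 2 + \<bar>a\<bar> powr r + \<bar>b\<bar> powr r"
      have "2 * (\<bar>a\<bar> powr 2 * I 2 g0 + \<bar>b\<bar> powr 2 * I 2 g1)
        + 2 powr r / r * (\<bar>a\<bar> powr r * I' r w0 + \<bar>b\<bar> powr r * I' r w1)
        \<le> 2 * (S * I 2 g0 + S * I 2 g1) + 2 powr r / r * (S * I' r w0 + S * I' r w1)"
        using \<open>r > 1\<close> I_nonneg by (intro add_mono mult_left_mono mult_right_mono) (auto simp: S_def)
      also have "\<dots> = C * S"
        by (simp add: C_def algebra_simps add_divide_distrib)
      finally show ?thesis by (simp add: S_def)
    qed
    finally show ?thesis
      using H unfolding W_def v_def[symmetric] by (simp add: v_def[abs_def] ennreal_leI)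
  qed
  moreover have "C \<ge> 0"
    using I_nonneg \<open>r > 1\<close> by (simp add: C_def)
  ultimately show thesis by (intro that)
qed

section \<open>Uniqueness of weak time derivatives\<close>

definition L2_L2_loc :: "(real \<Rightarrow> 'a::euclidean_space \<Rightarrow> real) set" where
  "L2_L2_loc = (\<Inter>T\<in>{0<..}. L2_L2 {0<..<T})"

lemma L2_L2_loc_measurable:
  assumes "v \<in> L2_L2_loc"
  shows "(\<lambda>(t, x). indicator {0<..} t * v t x) \<in> borel_measurable (lborel \<Otimes>\<^sub>M lborel)"
proof (rule borel_measurable_LIMSEQ_real)
  show "(\<lambda>p. indicator ({0<..<real (Suc n)} \<times> UNIV) p *\<^sub>R (case p of (t, x) \<Rightarrow> v t x))
      \<in> borel_measurable (lborel \<Otimes>\<^sub>M lborel)" for n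
    using assms by (auto simp: L2_L2_loc_def L2_L2_def set_borel_measurable_def)
  show "(\<lambda>n. indicator ({0<..<real (Suc n)} \<times> UNIV) p *\<^sub>R (case p of (t, x) \<Rightarrow> v t x))
      \<longlonglongrightarrow> (case p of (t, x) \<Rightarrow> indicator {0<..} t * v t x)" for p
  proof -
    obtain t x where p: "p = (t, x)" by fastforce
    obtain N :: nat where "t < real N" using reals_Archimedean2 by blast
    then have "eventually (\<lambda>n. t < real (Suc n)) sequentially"
      by (intro eventually_sequentiallyI[of N]) auto
    then have "eventually (\<lambda>n. (case p of (t, x) \<Rightarrow> indicator {0<..} t * v t x)
        = indicator ({0<..<real (Suc n)} \<times> UNIV) p *\<^sub>R (case p of (t, x) \<Rightarrow> v t x)) sequentially"
      by eventually_elim (auto simp: p indicator_def)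
    then show ?thesis
      by (rule Lim_transform_eventually[OF tendsto_const])
  qed
qed

lemma L2_L2_loc_measurable_time:
  assumes "v \<in> L2_L2_loc"
  shows "(\<lambda>t. indicator {0<..} t * v t x) \<in> borel_measurable borel"
  using measurable_compose[OF measurable_Pair2' L2_L2_loc_measurable[OF assms], of x] by simp

lemma AE_pos_time_commute:
  fixes v1 v2 :: "real \<Rightarrow> 'a::euclidean_space \<Rightarrow> real"
  assumes "v1 \<in> L2_L2_loc" "v2 \<in> L2_L2_loc"
  shows "(AE t in lborel. t > 0 \<longrightarrow> (AE x in lborel. v1 t x = v2 t x))
    \<longleftrightarrow> (AE x in lborel. AE t in lborel. t > 0 \<longrightarrow> v1 t x = v2 t x)"
proof -
  note [measurable] = assms[THEN L2_L2_loc_measurable]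
  have "Measurable.pred (lborel \<Otimes>\<^sub>M lborel)
      (\<lambda>p. (case p of (t, x) \<Rightarrow> indicator {0<..} t * v1 t x) = (case p of (t, x) \<Rightarrow> indicator {0<..} t * v2 t x))"
    by measurable
  also have "(\<lambda>p. (case p of (t, x) \<Rightarrow> indicator {0<..} t * v1 t x) = (case p of (t, x) \<Rightarrow> indicator {0<..} t * v2 t x))
      = (\<lambda>p. fst p > 0 \<longrightarrow> v1 (fst p) (snd p) = v2 (fst p) (snd p))"
    by (auto simp: fun_eq_iff)
  finally have "{p \<in> space (lborel \<Otimes>\<^sub>M lborel). fst p > 0 \<longrightarrow> v1 (fst p) (snd p) = v2 (fst p) (snd p)}
      \<in> sets ((lborel :: real measure) \<Otimes>\<^sub>M (lborel :: 'a measure))"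
    unfolding pred_def .
  from lborel_pair.AE_commute[OF this] show ?thesis by simp
qed

text \<open>By Tonelli, square integrability in space-time passes to the time sections at almost every \<open>x\<close>.\<close>

lemma L2_L2_section_integrable:
  fixes v :: "real \<Rightarrow> 'a::euclidean_space \<Rightarrow> real"
  assumes v: "v \<in> L2_L2 {0<..<T}"
  shows "AE x in lborel. set_integrable lborel {0<..<T} (\<lambda>t. v t x)"
proof -
  let ?I = "{0<..<T}"
  define V where "V t x = indicator ?I t * v t x" for t x
  have V[measurable]: "(\<lambda>(t, x). V t x) \<in> borel_measurable (lborel \<Otimes>\<^sub>M lborel)"
  proof -
    have "(\<lambda>p. indicator (?I \<times> UNIV) p *\<^sub>R (case p of (t, x) \<Rightarrow> v t x)) \<in> borel_measurable (lborel \<Otimes>\<^sub>M lborel)"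
      using v by (simp add: L2_L2_def set_borel_measurable_def)
    also have "(\<lambda>p. indicator (?I \<times> UNIV) p *\<^sub>R (case p of (t, x) \<Rightarrow> v t x)) = (\<lambda>(t, x). V t x)"
      by (auto simp: V_def indicator_def fun_eq_iff)
    finally show ?thesis .
  qed
  have "(\<integral>\<^sup>+x. (\<integral>\<^sup>+t. ennreal ((V t x)\<^sup>2) \<partial>lborel) \<partial>lborel) = (\<integral>\<^sup>+t. (\<integral>\<^sup>+x. ennreal ((V t x)\<^sup>2) \<partial>lborel) \<partial>lborel)"
    by (rule lborel_pair.Fubini') measurable
  also have "\<dots> = (\<integral>\<^sup>+t\<in>?I. ennreal ((Lp_norm 2 (v t))\<^sup>2) \<partial>lborel)"
  proof (rule nn_integral_cong_AE)
    have "AE t in lborel. t \<in> ?I \<longrightarrow> v t \<in> Lp_space 2"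
      using v by (simp add: L2_L2_def)
    then show "AE t in lborel. (\<integral>\<^sup>+x. ennreal ((V t x)\<^sup>2) \<partial>lborel)
        = ennreal ((Lp_norm 2 (v t))\<^sup>2) * indicator ?I t"
    proof eventually_elim
      case (elim t)
      show ?case
      proof (cases "t \<in> ?I")
        case True
        then have "integrable lborel (\<lambda>x. norm (v t x) powr 2)"
          using elim Lp_spaceD(2) by blast
        from nn_integral_eq_integral[OF this] True show ?thesis
          by (simp add: V_def Lp_norm_2_sq powr_numeral)
      qed (simp add: V_def)
    qed
  qed
  also have "\<dots> < \<infinity>"
    using v by (simp add: L2_L2_def)
  finally have "(\<integral>\<^sup>+x. (\<integral>\<^sup>+t. ennreal ((V t x)\<^sup>2) \<partial>lborel) \<partial>lborel) \<noteq> \<infinity>"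
    by simp
  then have "AE x in lborel. (\<integral>\<^sup>+t. ennreal ((V t x)\<^sup>2) \<partial>lborel) \<noteq> \<infinity>"
    by (intro nn_integral_PInf_AE) measurable
  then show ?thesis
  proof eventually_elim
    case (elim x)
    have Vx[measurable]: "(\<lambda>t. V t x) \<in> borel_measurable lborel"
      using measurable_compose[OF measurable_Pair2' V, of x] by simp
    have "integrable lborel (\<lambda>t. (V t x)\<^sup>2)"
      using elim by (intro integrableI_bounded) (auto simp: less_top)
    moreover have "integrable lborel (indicator ?I :: real \<Rightarrow> real)"
      by (cases "T \<ge> 0") auto
    ultimately have int: "integrable lborel (\<lambda>t. (V t x)\<^sup>2 + indicator ?I t)"
      by simp
    have "integrable lborel (\<lambda>t. V t x)"
    proof (rule Bochner_Integration.integrable_bound[OF int Vx], rule AE_I2)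
      fix t
      have "\<bar>y\<bar> \<le> y\<^sup>2 + 1" for y :: real
        using sum_squares_bound[of "\<bar>y\<bar>" 1] by (simp add: power2_eq_square[symmetric])
      then show "norm (V t x) \<le> norm ((V t x)\<^sup>2 + indicator ?I t)"
        by (auto simp: V_def indicator_def)
    qed
    then show ?case
      by (simp add: set_integrable_def V_def)
  qed
qed

lemma L2_L2_loc_section_integrable:
  assumes "v \<in> L2_L2_loc"
  shows "AE x in lborel. \<forall>n::nat. set_integrable lborel {0<..<real n} (\<lambda>t. v t x)"
  unfolding AE_all_countable
proof
  fix n :: nat
  show "AE x in lborel. set_integrable lborel {0<..<real n} (\<lambda>t. v t x)"
  proof (cases "n = 0")
    case False
    with assms have "v \<in> L2_L2 {0<..<real n}" by (auto simp: L2_L2_loc_def)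
    then show ?thesis by (rule L2_L2_section_integrable)
  qed (simp add: set_integrable_def)
qed

text \<open>The exceptional null set of \<open>x\<close> in the definition of the weak derivative depends on the test
  function. Countably many test functions decide whether a function of time vanishes, so one
  null set serves for all of them.\<close>

lemma is_weak_time_deriv_unique:
  fixes v1 v2 :: "real \<Rightarrow> 'a::euclidean_space \<Rightarrow> real"
  assumes v: "v1 \<in> L2_L2_loc" "v2 \<in> L2_L2_loc"
    and w: "is_weak_time_deriv {0<..} u v1" "is_weak_time_deriv {0<..} u v2"
  shows "AE t in lborel. t > 0 \<longrightarrow> (AE x in lborel. v1 t x = v2 t x)"
  unfolding AE_pos_time_commute[OF v]
proof -
  let ?P = "{0<..} :: real set"
  have "AE x in lborel. \<forall>\<psi>\<in>rational_bumps ?P.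
      (LINT t:?P|lborel. \<psi> t * v1 t x) = (LINT t:?P|lborel. \<psi> t * v2 t x)"
    unfolding AE_ball_countable[OF countable_rational_bumps]
  proof
    fix \<psi> assume "\<psi> \<in> rational_bumps ?P"
    then have \<psi>: "\<psi> \<in> test_functions ?P"
      using rational_bumps_test_functions by (rule subsetD[rotated])
    show "AE x in lborel. (LINT t:?P|lborel. \<psi> t * v1 t x) = (LINT t:?P|lborel. \<psi> t * v2 t x)"
      using w[unfolded is_weak_time_deriv_def, THEN bspec, OF \<psi>] by eventually_elim simp
  qed
  then show "AE x in lborel. AE t in lborel. t > 0 \<longrightarrow> v1 t x = v2 t x"
    using v[THEN L2_L2_loc_section_integrable]
  proof eventually_elim
    case (elim x)
    have "AE t in lborel. t \<in> ?P \<longrightarrow> v1 t x - v2 t x = 0"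
    proof (rule fundamental_lemma)
      fix a b :: real assume ab: "cbox a b \<subseteq> ?P"
      obtain n :: nat where "b < real n" using reals_Archimedean2 by blast
      with ab have sub: "cbox a b \<subseteq> {0<..<real n}" by auto
      show "set_integrable lborel (cbox a b) (\<lambda>t. v1 t x - v2 t x)"
        by (rule set_integrable_subset[OF _ _ sub]) (use elim in auto)
    next
      fix \<psi> assume "\<psi> \<in> rational_bumps ?P"
      then obtain a b k where \<psi>: "\<psi> = box_bump a b k" and ab: "cbox a b \<subseteq> ?P"
        unfolding rational_bumps_def by blast
      obtain n :: nat where "b < real n" using reals_Archimedean2 by blast
      with ab have out: "\<psi> t = 0" if "t \<notin> {0<..<real n}" for t
        unfolding \<psi> using that by (intro box_bump_outside) (auto simp: box_real subset_eq)
      have meas[measurable]: "\<psi> \<in> borel_measurable borel"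
        using box_bump_test_function[OF ab, of k] L2_test_function(1) Lp_spaceD(1) \<psi> by blast
      have int: "integrable lborel (\<lambda>t. \<psi> t * v t x)"
        if "set_integrable lborel {0<..<real n} (\<lambda>t. v t x)" for v :: "real \<Rightarrow> 'a \<Rightarrow> real"
      proof -
        have i: "integrable lborel (\<lambda>t. indicator {0<..<real n} t * v t x)"
          using that by (simp add: set_integrable_def)
        have "integrable lborel (\<lambda>t. \<psi> t * (indicator {0<..<real n} t * v t x))"
        proof (rule Bochner_Integration.integrable_bound[OF i])
          show "AE t in lborel. norm (\<psi> t * (indicator {0<..<real n} t * v t x))
              \<le> norm (indicator {0<..<real n} t * v t x)"
            using box_bump_bounds[of a b k] \<psi> by (auto simp: abs_mult intro!: mult_left_le_one_le)
        qed (use borel_measurable_integrable[OF i] in measurable)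
        also have "(\<lambda>t. \<psi> t * (indicator {0<..<real n} t * v t x)) = (\<lambda>t. \<psi> t * v t x)"
          using out by (auto simp: indicator_def fun_eq_iff)
        finally show ?thesis .
      qed
      have "(LINT t:?P|lborel. \<psi> t * v t x) = (\<integral>t. \<psi> t * v t x \<partial>lborel)" for v :: "real \<Rightarrow> 'a \<Rightarrow> real"
        unfolding set_lebesgue_integral_def
        by (rule Bochner_Integration.integral_cong) (use out in \<open>auto simp: indicator_def\<close>)
      with elim(1) \<open>\<psi> \<in> rational_bumps ?P\<close>
      have "(\<integral>t. \<psi> t * v1 t x \<partial>lborel) = (\<integral>t. \<psi> t * v2 t x \<partial>lborel)"
        by metis
      then show "(\<integral>t. \<psi> t * (v1 t x - v2 t x) \<partial>lborel) = 0"
        using int[of v1] int[of v2] elim by (simp add: right_diff_distrib)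
    qed simp
    then show ?case by simp
  qed
qed

lemma deriv_test_function:
  fixes \<psi> :: "real \<Rightarrow> real"
  assumes "\<psi> \<in> test_functions I"
  obtains K where "compact K" "K \<subseteq> I" "\<And>t. t \<notin> K \<Longrightarrow> \<psi> t = 0" "\<And>t. t \<notin> K \<Longrightarrow> deriv \<psi> t = 0"
    "\<And>t. (\<psi> has_real_derivative deriv \<psi> t) (at t)"
    "continuous_on UNIV \<psi>" "continuous_on UNIV (deriv \<psi>)"
proof -
  obtain K where K: "compact K" "K \<subseteq> I" "\<And>x. x \<notin> K \<Longrightarrow> \<psi> x = 0"
    and D: "\<And>x. (\<psi> has_derivative frechet_derivative \<psi> (at x)) (at x)"
    and D0: "\<And>x b. x \<notin> K \<Longrightarrow> frechet_derivative \<psi> (at x) b = 0"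
    and C: "continuous_on UNIV \<psi>" "\<And>b. b \<in> Basis \<Longrightarrow> continuous_on UNIV (\<lambda>x. frechet_derivative \<psi> (at x) b)"
    by (rule test_functionsE[OF assms]) (rule that; simp)
  have D': "(\<psi> has_real_derivative frechet_derivative \<psi> (at x) 1) (at x)" for x
  proof (rule has_derivative_imp_has_field_derivative[OF D[of x]])
    show "h * frechet_derivative \<psi> (at x) 1 = frechet_derivative \<psi> (at x) h" for h
      using linear_cmul[OF has_derivative_linear[OF D[of x]], of h 1] by simp
  qed
  then have "deriv \<psi> = (\<lambda>x. frechet_derivative \<psi> (at x) 1)"
    by (auto intro: DERIV_imp_deriv)
  then show thesis
    using that K D0 D' C by simp
qed

text \<open>The second derivative of \<open>u\<close> is formed from the chosen first derivative, which is only known up to null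
  sets. This lemma transfers weak derivatives from an explicit representative to the chosen one.\<close>

lemma is_weak_time_deriv_cong:
  fixes u1 u2 :: "real \<Rightarrow> 'a::euclidean_space \<Rightarrow> real"
  assumes u: "u1 \<in> L2_L2_loc" "u2 \<in> L2_L2_loc"
    and eq: "AE t in lborel. t > 0 \<longrightarrow> (AE x in lborel. u1 t x = u2 t x)"
    and w: "is_weak_time_deriv {0<..} u1 v"
  shows "is_weak_time_deriv {0<..} u2 v"
  unfolding is_weak_time_deriv_def
proof
  fix \<psi> :: "real \<Rightarrow> real" assume \<psi>: "\<psi> \<in> test_functions {0<..}"
  then have [measurable]: "deriv \<psi> \<in> borel_measurable borel"
    by (elim deriv_test_function) (auto intro: borel_measurable_continuous_onI)
  have "AE x in lborel. AE t in lborel. t > 0 \<longrightarrow> u1 t x = u2 t x"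
    using eq AE_pos_time_commute[OF u] by blast
  then show "AE x in lborel. (LINT t:{0<..}|lborel. deriv \<psi> t * u2 t x) = - (LINT t:{0<..}|lborel. \<psi> t * v t x)"
    using w[unfolded is_weak_time_deriv_def, THEN bspec, OF \<psi>]
  proof eventually_elim
    case (elim x)
    note [measurable] = L2_L2_loc_measurable_time[OF u(1), of x] L2_L2_loc_measurable_time[OF u(2), of x]
    have "(\<integral>t. deriv \<psi> t * (indicator {0<..} t * u2 t x) \<partial>lborel)
        = (\<integral>t. deriv \<psi> t * (indicator {0<..} t * u1 t x) \<partial>lborel)"
    proof (rule integral_cong_AE)
      show "AE t in lborel. deriv \<psi> t * (indicator {0<..} t * u2 t x) = deriv \<psi> t * (indicator {0<..} t * u1 t x)"
        using elim(1) by eventually_elim (auto simp: indicator_def)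
    qed measurable
    then show ?case
      using elim(2) by (simp add: set_lebesgue_integral_def mult.left_commute)
  qed
qed

lemma time_deriv_AE_eq:
  assumes "v \<in> L2_L2_loc" "is_weak_time_deriv {0<..} u v"
  shows "time_deriv u \<in> L2_L2_loc" "is_weak_time_deriv {0<..} u (time_deriv u)"
    and "AE t in lborel. t > 0 \<longrightarrow> (AE x in lborel. time_deriv u t x = v t x)"
proof -
  have "(\<forall>T>0. time_deriv u \<in> L2_L2 {0<..<T}) \<and> is_weak_time_deriv {0<..} u (time_deriv u)"
    unfolding time_deriv_def by (rule someI[of _ v]) (use assms in \<open>auto simp: L2_L2_loc_def\<close>)
  then show *: "time_deriv u \<in> L2_L2_loc" "is_weak_time_deriv {0<..} u (time_deriv u)"
    by (auto simp: L2_L2_loc_def)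
  show "AE t in lborel. t > 0 \<longrightarrow> (AE x in lborel. time_deriv u t x = v t x)"
    by (rule is_weak_time_deriv_unique[OF *(1) assms(1) *(2) assms(2)])
qed

lemma L2_L2_loc_AE_Lp_space:
  assumes "v \<in> L2_L2_loc"
  shows "AE t in lborel. t > 0 \<longrightarrow> v t \<in> Lp_space 2"
proof -
  have "AE t in lborel. \<forall>n::nat. t \<in> {0<..<real (Suc n)} \<longrightarrow> v t \<in> Lp_space 2"
    unfolding AE_all_countable
  proof
    fix n :: nat
    have "v \<in> L2_L2 {0<..<real (Suc n)}"
      using assms by (auto simp: L2_L2_loc_def)
    then show "AE t in lborel. t \<in> {0<..<real (Suc n)} \<longrightarrow> v t \<in> Lp_space 2"
      by (simp add: L2_L2_def)
  qed
  then show ?thesis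
  proof eventually_elim
    case (elim t)
    obtain n :: nat where "t < real n" using reals_Archimedean2 by blast
    then have "t < real (Suc n)" by simp
    with elim show ?case by auto
  qed
qed

lemma Lp_norm_cong_AE:
  assumes "f \<in> Lp_space p" "g \<in> Lp_space p" "AE x in lborel. f x = g x"
  shows "Lp_norm p f = Lp_norm p g"
proof -
  note [measurable] = Lp_spaceD(1)[OF assms(1)] Lp_spaceD(1)[OF assms(2)]
  have "(\<integral>x. norm (f x) powr p \<partial>lborel) = (\<integral>x. norm (g x) powr p \<partial>lborel)"
    by (rule integral_cong_AE) (use assms(3) in auto)
  then show ?thesis by (simp add: Lp_norm_def)
qed

lemma Lp_norm_time_deriv_twice:
  assumes v: "v \<in> L2_L2_loc" "is_weak_time_deriv {0<..} u v"
    and z: "z \<in> L2_L2_loc" "is_weak_time_deriv {0<..} v z"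
  shows "AE t in lborel. t > 0 \<longrightarrow> Lp_norm 2 (time_deriv (time_deriv u) t) = Lp_norm 2 (z t)"
proof -
  note d = time_deriv_AE_eq[OF v]
  have "AE t in lborel. t > 0 \<longrightarrow> (AE x in lborel. v t x = time_deriv u t x)"
    using d(3) by (simp add: eq_commute)
  then have "is_weak_time_deriv {0<..} (time_deriv u) z"
    by (rule is_weak_time_deriv_cong[OF v(1) d(1) _ z(2)])
  note dd = time_deriv_AE_eq[OF z(1) this]
  show ?thesis
    using dd(3) L2_L2_loc_AE_Lp_space[OF dd(1)] L2_L2_loc_AE_Lp_space[OF z(1)]
    by eventually_elim (auto intro: Lp_norm_cong_AE)
qed

section \<open>Competitors with separated variables\<close>

text \<open>The first mode carries the initial value and the exponential growth, the second one the initial velocity.\<close>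

definition two_mode ::
    "(real \<Rightarrow> real) \<Rightarrow> (real \<Rightarrow> real) \<Rightarrow> ('a \<Rightarrow> real) \<Rightarrow> ('a \<Rightarrow> real) \<Rightarrow> real \<Rightarrow> 'a \<Rightarrow> real" where
  "two_mode a b w0 w1 t x = a t * w0 x + b t * w1 x"

lemma two_mode_L2:
  fixes w0 w1 :: "'a::euclidean_space \<Rightarrow> real"
  assumes "w0 \<in> Lp_space 2" "w1 \<in> Lp_space 2"
  shows "two_mode a b w0 w1 t \<in> Lp_space 2"
    and "(Lp_norm 2 (two_mode a b w0 w1 t))\<^sup>2
      \<le> 4 * (\<bar>a t\<bar>\<^sup>2 * (Lp_norm 2 w0)\<^sup>2 + \<bar>b t\<bar>\<^sup>2 * (Lp_norm 2 w1)\<^sup>2)"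
  using Lp_lincomb[of 2 w0 w1 "a t" "b t"] assms
  by (simp_all add: two_mode_def[abs_def] Lp_norm_2_sq powr_numeral)

lemma two_mode_L2_L2:
  fixes w0 w1 :: "'a::euclidean_space \<Rightarrow> real"
  assumes w: "w0 \<in> Lp_space 2" "w1 \<in> Lp_space 2"
    and cont: "continuous_on UNIV a" "continuous_on UNIV b"
  shows "two_mode a b w0 w1 \<in> L2_L2 {0<..<T}"
proof -
  note [measurable] = w[THEN Lp_spaceD(1)] cont[THEN borel_measurable_continuous_onI]
  define N where "N t = 4 * (\<bar>a t\<bar>\<^sup>2 * (Lp_norm 2 w0)\<^sup>2 + \<bar>b t\<bar>\<^sup>2 * (Lp_norm 2 w1)\<^sup>2)" for t
  have bound: "(Lp_norm 2 (two_mode a b w0 w1 t))\<^sup>2 \<le> N t" for t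
    unfolding N_def by (rule two_mode_L2(2)[OF w])
  have "continuous_on {0..T} N"
    unfolding N_def by (intro continuous_intros continuous_on_subset[OF cont(1)] continuous_on_subset[OF cont(2)]) auto
  then have "integrable lborel (\<lambda>t. indicator {0..T} t *\<^sub>R N t)"
    by (intro borel_integrable_compact) auto
  then have fin: "(\<integral>\<^sup>+t. ennreal (norm (indicator {0..T} t *\<^sub>R N t)) \<partial>lborel) < \<infinity>"
    by (simp add: integrable_iff_bounded)
  have "(\<integral>\<^sup>+t\<in>{0<..<T}. ennreal ((Lp_norm 2 (two_mode a b w0 w1 t))\<^sup>2) \<partial>lborel)
      \<le> (\<integral>\<^sup>+t. ennreal (norm (indicator {0..T} t *\<^sub>R N t)) \<partial>lborel)"
  proof (intro nn_integral_mono)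
    fix t
    show "ennreal ((Lp_norm 2 (two_mode a b w0 w1 t))\<^sup>2) * indicator {0<..<T} t
        \<le> ennreal (norm (indicator {0..T} t *\<^sub>R N t))"
      using bound[of t] by (auto simp: indicator_def intro!: ennreal_leI)
  qed
  also note fin
  finally have "(\<integral>\<^sup>+t\<in>{0<..<T}. ennreal ((Lp_norm 2 (two_mode a b w0 w1 t))\<^sup>2) \<partial>lborel) < \<infinity>" .
  moreover have "set_borel_measurable (lborel \<Otimes>\<^sub>M lborel) ({0<..<T} \<times> UNIV) (\<lambda>(t, x). two_mode a b w0 w1 t x)"
    unfolding set_borel_measurable_def two_mode_def by measurable
  ultimately show ?thesis
    using two_mode_L2(1)[OF w] by (simp add: L2_L2_def)
qed

text \<open>The product \<open>\<psi> f\<close> has compact support inside \<open>I\<close>, so the integral of its derivative over a large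
  interval vanishes and no boundary terms appear, whatever the set \<open>I\<close> is.\<close>

lemma test_function_by_parts:
  assumes \<psi>: "\<psi> \<in> test_functions I"
    and f: "\<And>t. (f has_real_derivative f' t) (at t)" and f': "continuous_on UNIV f'"
  shows "(LINT t:I|lborel. deriv \<psi> t * f t) = - (LINT t:I|lborel. \<psi> t * f' t)"
proof -
  obtain K where K: "compact K" "K \<subseteq> I" "\<And>t. t \<notin> K \<Longrightarrow> \<psi> t = 0" "\<And>t. t \<notin> K \<Longrightarrow> deriv \<psi> t = 0"
    and D: "\<And>t. (\<psi> has_real_derivative deriv \<psi> t) (at t)"
    and C: "continuous_on UNIV \<psi>" "continuous_on UNIV (deriv \<psi>)"
    by (rule deriv_test_function[OF \<psi>]) (rule that; simp)
  have cf: "continuous_on UNIV f"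
    using f by (auto intro!: continuous_at_imp_continuous_on DERIV_isCont)
  have restrict: "(LINT t:I|lborel. h t) = (\<integral>t. h t \<partial>lborel)" "integrable lborel h"
    if "continuous_on UNIV h" "\<And>t. t \<notin> K \<Longrightarrow> h t = 0" for h :: "real \<Rightarrow> real"
  proof -
    show "(LINT t:I|lborel. h t) = (\<integral>t. h t \<partial>lborel)"
      unfolding set_lebesgue_integral_def
      by (rule Bochner_Integration.integral_cong) (use that K in \<open>auto simp: indicator_def\<close>)
    have "integrable lborel (\<lambda>t. indicator K t *\<^sub>R h t)"
      by (intro borel_integrable_compact K continuous_on_subset[OF that(1)]) auto
    also have "(\<lambda>t. indicator K t *\<^sub>R h t) = h"
      using that by (auto simp: indicator_def fun_eq_iff)
    finally show "integrable lborel h" .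
  qed
  obtain B where B: "\<And>t. t \<in> K \<Longrightarrow> \<bar>t\<bar> \<le> B" "B > 0"
    using compact_imp_bounded[OF K(1)] unfolding bounded_pos real_norm_def by blast
  have cont: "continuous_on UNIV (\<lambda>t. deriv \<psi> t * f t)" "continuous_on UNIV (\<lambda>t. \<psi> t * f' t)"
    by (intro continuous_intros C cf f')+
  then have cont': "continuous_on UNIV (\<lambda>t. deriv \<psi> t * f t + \<psi> t * f' t)"
    by (rule continuous_on_add)
  have "(\<integral>t. (deriv \<psi> t * f t + \<psi> t * f' t) * indicator {- B - 1..B + 1} t \<partial>lborel)
      = \<psi> (B + 1) * f (B + 1) - \<psi> (- B - 1) * f (- B - 1)"
  proof (rule integral_FTC_Icc_real)
    show "((\<lambda>t. \<psi> t * f t) has_real_derivative deriv \<psi> t * f t + \<psi> t * f' t) (at t)" for t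
      by (rule DERIV_cong[OF DERIV_mult[OF D f]]) simp
    show "isCont (\<lambda>t. deriv \<psi> t * f t + \<psi> t * f' t) t" for t
      using cont' by (simp add: continuous_on_eq_continuous_at)
  qed (use B in auto)
  also have "\<dots> = 0"
    using K(3)[of "B + 1"] K(3)[of "- B - 1"] B by force
  also have "(\<lambda>t. (deriv \<psi> t * f t + \<psi> t * f' t) * indicator {- B - 1..B + 1} t)
      = (\<lambda>t. deriv \<psi> t * f t + \<psi> t * f' t)"
  proof
    fix t
    show "(deriv \<psi> t * f t + \<psi> t * f' t) * indicator {- B - 1..B + 1} t = deriv \<psi> t * f t + \<psi> t * f' t"
      using K(3,4)[of t] B(1)[of t] by (cases "t \<in> K") (auto simp: indicator_def)
  qed
  finally have "(\<integral>t. deriv \<psi> t * f t \<partial>lborel) + (\<integral>t. \<psi> t * f' t \<partial>lborel) = 0"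
    using restrict(2)[OF cont(1)] restrict(2)[OF cont(2)] K by simp
  then show ?thesis
    using restrict(1)[OF cont(1)] restrict(1)[OF cont(2)] K by simp
qed

lemma two_mode_weak_time_deriv:
  assumes "\<And>t. (a has_real_derivative a' t) (at t)" "continuous_on UNIV a'"
    and "\<And>t. (b has_real_derivative b' t) (at t)" "continuous_on UNIV b'"
  shows "is_weak_time_deriv I (two_mode a b w0 w1) (two_mode a' b' w0 w1)"
  unfolding is_weak_time_deriv_def two_mode_def
  by (intro ballI AE_I2 test_function_by_parts)
     (auto intro!: derivative_eq_intros assms continuous_intros)

lemma two_mode_initial_value:
  fixes w0 w1 :: "'a::euclidean_space \<Rightarrow> real"
  assumes w: "w0 \<in> Lp_space 2" "w1 \<in> Lp_space 2"
    and cont: "continuous_on UNIV a" "continuous_on UNIV b"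
    and u: "AE t in lborel. t > 0 \<longrightarrow> (AE x in lborel. u t x = two_mode a b w0 w1 t x)"
  shows "has_initial_value u (two_mode a b w0 w1 0)"
  unfolding has_initial_value_def
proof (intro exI[of _ "two_mode a b w0 w1"] conjI allI impI)
  fix s :: real
  have at: "(a \<longlongrightarrow> a s) (at s within {0..})" "(b \<longlongrightarrow> b s) (at s within {0..})"
    using cont by (auto simp: continuous_on_eq_continuous_at isCont_def intro: tendsto_within_subset)
  define D where "D t = 4 * (\<bar>a t - a s\<bar>\<^sup>2 * (Lp_norm 2 w0)\<^sup>2 + \<bar>b t - b s\<bar>\<^sup>2 * (Lp_norm 2 w1)\<^sup>2)" for t
  have "(D \<longlongrightarrow> 4 * (\<bar>a s - a s\<bar>\<^sup>2 * (Lp_norm 2 w0)\<^sup>2 + \<bar>b s - b s\<bar>\<^sup>2 * (Lp_norm 2 w1)\<^sup>2)) (at s within {0..})"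
    unfolding D_def by (intro tendsto_intros at)
  then have "(D \<longlongrightarrow> 0) (at s within {0..})" by simp
  then have lim: "((\<lambda>t. sqrt (D t)) \<longlongrightarrow> 0) (at s within {0..})"
    using tendsto_real_sqrt by fastforce
  have "Lp_norm 2 (\<lambda>x. two_mode a b w0 w1 t x - two_mode a b w0 w1 s x) \<le> sqrt (D t)" for t
  proof (rule real_le_rsqrt)
    have "(\<lambda>x. two_mode a b w0 w1 t x - two_mode a b w0 w1 s x)
        = two_mode (\<lambda>t. a t - a s) (\<lambda>t. b t - b s) w0 w1 t"
      by (auto simp: two_mode_def algebra_simps)
    then show "(Lp_norm 2 (\<lambda>x. two_mode a b w0 w1 t x - two_mode a b w0 w1 s x))\<^sup>2 \<le> D t"
      using two_mode_L2(2)[OF w, of "\<lambda>t. a t - a s" "\<lambda>t. b t - b s" t] by (simp add: D_def)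
  qed
  then show "((\<lambda>t. Lp_norm 2 (\<lambda>x. two_mode a b w0 w1 t x - two_mode a b w0 w1 s x)) \<longlongrightarrow> 0) (at s within {0..})"
    by (intro tendsto_sandwich[OF _ _ tendsto_const lim]) (auto simp: Lp_norm_def)
next
  show "AE t in lborel. 0 < t \<longrightarrow> (AE x in lborel. two_mode a b w0 w1 t x = u t x)"
    using u by (simp add: eq_commute)
qed (use two_mode_L2(1)[OF w] in auto)

lemma two_mode_in_U0_space:
  fixes w0 w1 :: "'a::euclidean_space \<Rightarrow> real"
  assumes w: "w0 \<in> Lp_space 2" "w1 \<in> Lp_space 2"
    and a: "\<And>t. (a has_real_derivative a1 t) (at t)" "\<And>t. (a1 has_real_derivative a2 t) (at t)"
      "continuous_on UNIV a2" "a 0 = 1" "a1 0 = 0"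
    and b: "\<And>t. (b has_real_derivative b1 t) (at t)" "\<And>t. (b1 has_real_derivative b2 t) (at t)"
      "continuous_on UNIV b2" "b 0 = 0" "b1 0 = \<epsilon>"
    and fin: "(\<integral>\<^sup>+t\<in>{0<..}. ennreal (exp (- t) * (Lp_norm 2 (two_mode a2 b2 w0 w1 t))\<^sup>2) \<partial>lborel) < \<infinity>"
  shows "two_mode a b w0 w1 \<in> U0_space \<epsilon> w0 w1"
    and "AE t in lborel. t > 0 \<longrightarrow>
      Lp_norm 2 (time_deriv (time_deriv (two_mode a b w0 w1)) t) = Lp_norm 2 (two_mode a2 b2 w0 w1 t)"
proof -
  have c: "continuous_on UNIV a" "continuous_on UNIV a1" "continuous_on UNIV b" "continuous_on UNIV b1"
    using a(1,2) b(1,2) by (auto intro!: continuous_at_imp_continuous_on DERIV_isCont)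
  let ?u = "two_mode a b w0 w1" and ?v = "two_mode a1 b1 w0 w1" and ?z = "two_mode a2 b2 w0 w1"
  have L: "?u \<in> L2_L2 {0<..<T}" "?v \<in> L2_L2 {0<..<T}" "?z \<in> L2_L2 {0<..<T}" for T
    by (intro two_mode_L2_L2 w c a b)+
  then have loc: "?v \<in> L2_L2_loc" "?z \<in> L2_L2_loc"
    by (auto simp: L2_L2_loc_def)
  have wd: "is_weak_time_deriv I ?u ?v" "is_weak_time_deriv I ?v ?z" for I
    by (intro two_mode_weak_time_deriv a b c)+
  show eq: "AE t in lborel. t > 0 \<longrightarrow>
      Lp_norm 2 (time_deriv (time_deriv ?u) t) = Lp_norm 2 (?z t)"
    by (rule Lp_norm_time_deriv_twice[OF loc(1) wd(1) loc(2) wd(2)])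
  have "(\<integral>\<^sup>+t\<in>{0<..}. ennreal (exp (- t) * (Lp_norm 2 (time_deriv (time_deriv ?u) t))\<^sup>2) \<partial>lborel)
      = (\<integral>\<^sup>+t\<in>{0<..}. ennreal (exp (- t) * (Lp_norm 2 (?z t))\<^sup>2) \<partial>lborel)"
    by (rule nn_integral_cong_AE) (use eq in \<open>auto simp: indicator_def elim!: eventually_mono\<close>)
  moreover have "?u \<in> H2_loc"
    using L wd unfolding H2_loc_def H2_L2_def by blast
  ultimately have "?u \<in> U_space"
    using fin by (simp add: U_space_def)
  moreover have "has_initial_value ?u w0"
  proof -
    have "?u 0 = w0" using a b by (simp add: two_mode_def[abs_def])
    then show ?thesis using two_mode_initial_value[OF w c(1,3), of ?u] by simp
  qed
  moreover have "has_initial_value (time_deriv ?u) (\<lambda>x. \<epsilon> * w1 x)"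
  proof -
    have "?v 0 = (\<lambda>x. \<epsilon> * w1 x)" using a b by (simp add: two_mode_def[abs_def])
    then show ?thesis
      using two_mode_initial_value[OF w c(2,4) time_deriv_AE_eq(3)[OF loc(1) wd(1)]] by simp
  qed
  ultimately show "?u \<in> U0_space \<epsilon> w0 w1"
    by (simp add: U0_space_def)
qed

lemma nn_integral_exp_decay:
  assumes "c > 0"
  shows "(\<integral>\<^sup>+t. ennreal (exp (- c * t)) * indicator {0..} t \<partial>lborel) = ennreal (1 / c)"
proof -
  have "(\<integral>\<^sup>+t. ennreal (exp (- c * t)) * indicator {0..} t \<partial>lborel) = ennreal (0 - (- exp (- c * 0) / c))"
  proof (rule nn_integral_FTC_atLeast)
    show "((\<lambda>t. - exp (- c * t) / c) has_real_derivative exp (- c * t)) (at t)" for t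
      using assms by (auto intro!: derivative_eq_intros)
    have "((\<lambda>t. exp (- c * t)) \<longlongrightarrow> 0) at_top"
      using assms
      by (intro filterlim_compose[OF exp_at_bot] filterlim_tendsto_neg_mult_at_bot[OF tendsto_const])
         (auto simp: filterlim_ident)
    then have "((\<lambda>t. - exp (- c * t) / c) \<longlongrightarrow> - 0 / c) at_top"
      by (intro tendsto_intros) (use assms in auto)
    then show "((\<lambda>t. - exp (- c * t) / c) \<longlongrightarrow> 0) at_top" by simp
  qed auto
  then show ?thesis by simp
qed

text \<open>With \<open>m = max 2 r\<close>, every square and every \<open>r\<close>-th power of a coefficient is at most
  \<open>(K exp (\<alpha> t)) powr m\<close>, because this base is at least 1. Against the weight \<open>exp (- t)\<close> there remains a decay
  of rate \<open>1 - m \<alpha> > 0\<close>. The constant is chosen before the coefficients: it is the same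
  for all of them.\<close>

lemma two_mode_energy_bound:
  fixes w0 w1 :: "'a::euclidean_space \<Rightarrow> real"
  assumes "r > 1" and w: "w0 \<in> H_space r" "w1 \<in> H_space r"
    and "K \<ge> 1" "\<alpha> > 0" "max 2 r * \<alpha> < 1"
  obtains C where "C \<ge> 0"
    and "\<And>a b a2 b2. (\<And>t. t > 0 \<Longrightarrow> \<bar>a t\<bar> \<le> K * exp (\<alpha> * t) \<and> \<bar>b t\<bar> \<le> K * exp (\<alpha> * t) \<and>
          \<bar>a2 t\<bar> \<le> K * exp (\<alpha> * t) \<and> \<bar>b2 t\<bar> \<le> K * exp (\<alpha> * t)) \<Longrightarrow>
      (\<integral>\<^sup>+t\<in>{0<..}. ennreal (exp (- t)) * (ennreal (1 / (2 * \<epsilon>\<^sup>2) *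
        (Lp_norm 2 (two_mode a2 b2 w0 w1 t))\<^sup>2) + W r (two_mode a b w0 w1 t)) \<partial>lborel) \<le> ennreal C \<and>
      (\<integral>\<^sup>+t\<in>{0<..}. ennreal (exp (- t) * (Lp_norm 2 (two_mode a2 b2 w0 w1 t))\<^sup>2) \<partial>lborel) \<le> ennreal C"
proof -
  obtain C1 where C1: "C1 \<ge> 0" and W: "\<And>a b. W r (\<lambda>x. a * w0 x + b * w1 x)
      \<le> ennreal (C1 * (\<bar>a\<bar> powr 2 + \<bar>b\<bar> powr 2 + \<bar>a\<bar> powr r + \<bar>b\<bar> powr r))"
    by (rule W_lincomb_bound[OF \<open>r > 1\<close> w]) blast
  define m where "m = max 2 r"
  define c where "c = 1 - m * \<alpha>"
  have "c > 0" using assms by (simp add: c_def m_def)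
  define B where "B = 4 * ((Lp_norm 2 w0)\<^sup>2 + (Lp_norm 2 w1)\<^sup>2)"
  define D where "D = B + B / (2 * \<epsilon>\<^sup>2) + 4 * C1"
  have "B \<ge> 0" by (simp add: B_def)
  then have D: "B \<le> D" "B / (2 * \<epsilon>\<^sup>2) + 4 * C1 \<le> D" "D \<ge> 0"
    using C1 by (auto simp: D_def)
  define Q where "Q t = (K * exp (\<alpha> * t)) powr m" for t
  have expQ: "exp (- t) * Q t = K powr m * exp (- c * t)" for t
    using \<open>K \<ge> 1\<close> by (simp add: Q_def c_def powr_mult exp_powr_real exp_add[symmetric] algebra_simps)
  define C where "C = D * K powr m * (1 / c)"
  have "C \<ge> 0" using D \<open>c > 0\<close> by (simp add: C_def)
  have integral: "(\<integral>\<^sup>+t\<in>{0<..}. f t \<partial>lborel) \<le> ennreal C"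
    if "\<And>t. t > 0 \<Longrightarrow> f t \<le> ennreal (D * (exp (- t) * Q t))" for f
  proof -
    have "(\<integral>\<^sup>+t\<in>{0<..}. f t \<partial>lborel)
        \<le> (\<integral>\<^sup>+t. ennreal (D * K powr m) * (ennreal (exp (- c * t)) * indicator {0..} t) \<partial>lborel)"
    proof (intro nn_integral_mono)
      fix t
      show "f t * indicator {0<..} t \<le> ennreal (D * K powr m) * (ennreal (exp (- c * t)) * indicator {0..} t)"
      proof (cases "t > 0")
        case True
        have "f t \<le> ennreal (D * (K powr m * exp (- c * t)))"
          using that[OF True] by (simp only: expQ)
        with True D show ?thesis
          by (simp add: ennreal_mult[symmetric] mult.assoc)
      qed simp
    qed
    also have "\<dots> = ennreal (D * K powr m) * ennreal (1 / c)"
      using nn_integral_exp_decay[OF \<open>c > 0\<close>] by (subst nn_integral_cmult) auto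
    also have "\<dots> = ennreal C"
      using D \<open>c > 0\<close> by (simp add: C_def ennreal_mult[symmetric])
    finally show ?thesis .
  qed
  have "(\<integral>\<^sup>+t\<in>{0<..}. ennreal (exp (- t)) * (ennreal (1 / (2 * \<epsilon>\<^sup>2) *
        (Lp_norm 2 (two_mode a2 b2 w0 w1 t))\<^sup>2) + W r (two_mode a b w0 w1 t)) \<partial>lborel) \<le> ennreal C \<and>
      (\<integral>\<^sup>+t\<in>{0<..}. ennreal (exp (- t) * (Lp_norm 2 (two_mode a2 b2 w0 w1 t))\<^sup>2) \<partial>lborel) \<le> ennreal C"
    if bd: "\<And>t. t > 0 \<Longrightarrow> \<bar>a t\<bar> \<le> K * exp (\<alpha> * t) \<and> \<bar>b t\<bar> \<le> K * exp (\<alpha> * t) \<and>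
          \<bar>a2 t\<bar> \<le> K * exp (\<alpha> * t) \<and> \<bar>b2 t\<bar> \<le> K * exp (\<alpha> * t)" for a b a2 b2
  proof -
    let ?N = "\<lambda>t. (Lp_norm 2 (two_mode a2 b2 w0 w1 t))\<^sup>2"
    have powQ: "\<bar>y\<bar> powr p \<le> Q t" if "\<bar>y\<bar> \<le> K * exp (\<alpha> * t)" "p \<le> m" "p \<ge> 0" "t > 0" for y p t
    proof -
      have "1 \<le> K * exp (\<alpha> * t)"
        using mult_mono[of 1 K 1 "exp (\<alpha> * t)"] \<open>K \<ge> 1\<close> \<open>\<alpha> > 0\<close> that(4) by simp
      then have "(K * exp (\<alpha> * t)) powr p \<le> (K * exp (\<alpha> * t)) powr m"
        using that(2) by (intro powr_mono) auto
      moreover have "\<bar>y\<bar> powr p \<le> (K * exp (\<alpha> * t)) powr p"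
        using that by (intro powr_mono2) auto
      ultimately show ?thesis by (simp add: Q_def)
    qed
    have N: "?N t \<le> B * Q t" if "t > 0" for t
    proof -
      have "w0 \<in> Lp_space 2" "w1 \<in> Lp_space 2"
        using w by (auto simp: H_space_def H1_space_def)
      then have "?N t \<le> 4 * (\<bar>a2 t\<bar>\<^sup>2 * (Lp_norm 2 w0)\<^sup>2 + \<bar>b2 t\<bar>\<^sup>2 * (Lp_norm 2 w1)\<^sup>2)"
        by (rule two_mode_L2(2))
      also have "\<dots> \<le> 4 * (Q t * (Lp_norm 2 w0)\<^sup>2 + Q t * (Lp_norm 2 w1)\<^sup>2)"
      proof -
        have "\<bar>a2 t\<bar>\<^sup>2 \<le> Q t" "\<bar>b2 t\<bar>\<^sup>2 \<le> Q t"
          using powQ[of "a2 t" t 2] powQ[of "b2 t" t 2] bd[OF that] that by (auto simp: m_def powr_numeral)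
        then show ?thesis by (intro mult_left_mono add_mono mult_right_mono) auto
      qed
      also have "\<dots> = B * Q t" by (simp add: B_def algebra_simps)
      finally show ?thesis .
    qed
    have Wt: "W r (two_mode a b w0 w1 t) \<le> ennreal (4 * C1 * Q t)" if "t > 0" for t
    proof -
      have "\<bar>a t\<bar> powr 2 + \<bar>b t\<bar> powr 2 + \<bar>a t\<bar> powr r + \<bar>b t\<bar> powr r \<le> Q t + Q t + Q t + Q t"
        using bd[OF that] that \<open>r > 1\<close> by (intro add_mono powQ) (auto simp: m_def)
      then have "C1 * (\<bar>a t\<bar> powr 2 + \<bar>b t\<bar> powr 2 + \<bar>a t\<bar> powr r + \<bar>b t\<bar> powr r) \<le> 4 * C1 * Q t"
        using mult_left_mono[OF _ C1] by fastforce
      then show ?thesis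
        unfolding two_mode_def[abs_def] by (rule order_trans[OF W ennreal_leI])
    qed
    show ?thesis
    proof (intro conjI integral)
      fix t :: real assume "t > 0"
      have "ennreal (1 / (2 * \<epsilon>\<^sup>2) * ?N t) + W r (two_mode a b w0 w1 t)
          \<le> ennreal (1 / (2 * \<epsilon>\<^sup>2) * (B * Q t)) + ennreal (4 * C1 * Q t)"
        using N[OF \<open>t > 0\<close>] Wt[OF \<open>t > 0\<close>] by (intro add_mono ennreal_leI mult_left_mono) auto
      also have "\<dots> = ennreal ((B / (2 * \<epsilon>\<^sup>2) + 4 * C1) * Q t)"
        using \<open>B \<ge> 0\<close> C1 by (subst ennreal_plus[symmetric]) (auto simp: Q_def algebra_simps)
      also have "\<dots> \<le> ennreal (D * Q t)"
        using D(2) by (intro ennreal_leI mult_right_mono) (auto simp: Q_def)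
      finally have "ennreal (exp (- t)) * (ennreal (1 / (2 * \<epsilon>\<^sup>2) * ?N t) + W r (two_mode a b w0 w1 t))
          \<le> ennreal (exp (- t)) * ennreal (D * Q t)"
        by (intro mult_left_mono) auto
      also have "\<dots> = ennreal (D * (exp (- t) * Q t))"
        using D(3) by (simp add: ennreal_mult[symmetric] Q_def mult_ac)
      finally show "ennreal (exp (- t)) * (ennreal (1 / (2 * \<epsilon>\<^sup>2) * ?N t) + W r (two_mode a b w0 w1 t))
          \<le> ennreal (D * (exp (- t) * Q t))" .
      have "?N t \<le> D * Q t"
        using N[OF \<open>t > 0\<close>] mult_right_mono[OF D(1), of "Q t"] by (auto simp: Q_def)
      then have "exp (- t) * ?N t \<le> exp (- t) * (D * Q t)"
        by (intro mult_left_mono) auto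
      then show "ennreal (exp (- t) * ?N t) \<le> ennreal (D * (exp (- t) * Q t))"
        by (intro ennreal_leI) (simp add: mult_ac)
    qed
  qed
  with \<open>C \<ge> 0\<close> show thesis by (intro that) blast+
qed

section \<open>Exponentially growing profiles cut off at a late time\<close>

lemma DERIV_pos_part_power:
  "((\<lambda>s::real. max 0 s ^ (n + 2)) has_real_derivative real (n + 2) * max 0 s ^ (n + 1)) (at s)"
proof -
  consider "s > 0" | "s < 0" | "s = 0" by linarith
  then show ?thesis
  proof cases
    case 1
    have "((\<lambda>s. s ^ (n + 2)) has_real_derivative real (n + 2) * max 0 s ^ (n + 1)) (at s)"
      using DERIV_pow[of "n + 2" s] 1 by (simp add: max_def)
    then show ?thesis
      by (rule has_field_derivative_transform_within_open[of _ _ _ "{0<..}"])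
         (use 1 in \<open>auto simp: max_def\<close>)
  next
    case 2
    have "((\<lambda>s. 0) has_real_derivative real (n + 2) * max 0 s ^ (n + 1)) (at s)"
      using 2 by (simp add: max_def)
    then show ?thesis
      by (rule has_field_derivative_transform_within_open[of _ _ _ "{..<0}"])
         (use 2 in \<open>auto simp: max_def\<close>)
  next
    case 3
    have "((\<lambda>h::real. max 0 h ^ (n + 1)) \<longlongrightarrow> max 0 0 ^ (n + 1)) (at 0)"
      by (intro tendsto_intros)
    moreover have "eventually (\<lambda>h::real. max 0 h ^ (n + 1) = (max 0 (0 + h) ^ (n + 2) - max 0 0 ^ (n + 2)) / h) (at 0)"
      by (auto simp: eventually_at_filter max_def)
    ultimately have "((\<lambda>h::real. (max 0 (0 + h) ^ (n + 2) - max 0 0 ^ (n + 2)) / h) \<longlongrightarrow> 0) (at 0)"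
      using Lim_transform_eventually by fastforce
    then show ?thesis
      using 3 by (simp add: DERIV_def)
  qed
qed

text \<open>With \<open>p(s) = max 0 s ^ 3\<close>, the composition \<open>p (1 - p s)\<close> is a twice continuously
  differentiable transition from 1 to 0. Where it is not constant, \<open>p' \<le> 3\<close> and \<open>p'' \<le> 6\<close>, so the chain rule
  gives the bounds \<open>3 * 3\<close> and \<open>6 * 3\<^sup>2 + 3 * 6\<close>.\<close>

lemma C2_cutoff:
  obtains \<kappa> \<kappa>1 \<kappa>2 :: "real \<Rightarrow> real"
  where "\<And>s. (\<kappa> has_real_derivative \<kappa>1 s) (at s)" "\<And>s. (\<kappa>1 has_real_derivative \<kappa>2 s) (at s)"
    "continuous_on UNIV \<kappa>2"
    "\<And>s. s \<le> 0 \<Longrightarrow> \<kappa> s = 1" "\<And>s. s \<le> 0 \<Longrightarrow> \<kappa>1 s = 0" "\<And>s. s \<ge> 1 \<Longrightarrow> \<kappa> s = 0"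
    "\<And>s. 0 \<le> \<kappa> s" "\<And>s. \<kappa> s \<le> 1" "\<And>s. \<bar>\<kappa>1 s\<bar> \<le> 9" "\<And>s. \<bar>\<kappa>2 s\<bar> \<le> 72"
proof -
  define p p1 p2 :: "real \<Rightarrow> real"
    where "p = (\<lambda>s. max 0 s ^ 3)" and "p1 = (\<lambda>s. 3 * max 0 s ^ 2)" and "p2 = (\<lambda>s. 6 * max 0 s)"
  have p: "(p has_real_derivative p1 s) (at s)" for s
    using DERIV_pos_part_power[of 1 s] by (simp add: p_def p1_def numeral_3_eq_3 numeral_2_eq_2)
  have p1: "(p1 has_real_derivative p2 s) (at s)" for s
    using DERIV_cmult[OF DERIV_pos_part_power[of 0 s], of 3] by (simp add: p1_def p2_def numeral_2_eq_2)
  have cp: "continuous_on UNIV p" "continuous_on UNIV p1" "continuous_on UNIV p2"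
    unfolding p_def p1_def p2_def by (intro continuous_intros)+
  have pos: "p s \<ge> 0" "p1 s \<ge> 0" "p2 s \<ge> 0" for s
    by (auto simp: p_def p1_def p2_def)
  have zero: "p s = 0" "p1 s = 0" "p2 s = 0" if "s \<le> 0" for s
    using that by (auto simp: p_def p1_def p2_def max_def)
  have le: "p s \<le> 1" "p1 s \<le> 3" "p2 s \<le> 6" if "s \<le> 1" for s
    using that by (auto simp: p_def p1_def p2_def max_def power_le_one)
  have ge: "p s \<ge> 1" if "s \<ge> 1" for s
    using that by (auto simp: p_def max_def)
  define \<kappa> where "\<kappa> s = p (1 - p s)" for s
  define \<kappa>1 where "\<kappa>1 s = - (p1 (1 - p s) * p1 s)" for s
  define \<kappa>2 where "\<kappa>2 s = p2 (1 - p s) * (p1 s)\<^sup>2 - p1 (1 - p s) * p2 s" for s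
  have inner: "((\<lambda>s. 1 - p s) has_real_derivative - p1 s) (at s)" for s
    by (auto intro!: derivative_eq_intros p)
  show thesis
  proof (rule that[of \<kappa> \<kappa>1 \<kappa>2])
    show "(\<kappa> has_real_derivative \<kappa>1 s) (at s)" for s
      unfolding \<kappa>_def \<kappa>1_def by (rule DERIV_cong[OF DERIV_chain2[OF p inner]]) simp
    show "(\<kappa>1 has_real_derivative \<kappa>2 s) (at s)" for s
      unfolding \<kappa>1_def \<kappa>2_def
      by (rule DERIV_cong[OF DERIV_minus[OF DERIV_mult[OF DERIV_chain2[OF p1 inner] p1]]])
         (simp add: power2_eq_square algebra_simps)
    show "continuous_on UNIV \<kappa>2"
      unfolding \<kappa>2_def
      by (intro continuous_intros cp continuous_on_compose2[OF cp(3)] continuous_on_compose2[OF cp(2)]) auto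
    show "\<kappa> s = 1" "\<kappa>1 s = 0" if "s \<le> 0" for s
      using zero[OF that] by (simp_all add: \<kappa>_def \<kappa>1_def p_def)
    have far: "\<kappa> s = 0" "\<kappa>1 s = 0" "\<kappa>2 s = 0" if "s \<ge> 1" for s
      using zero[of "1 - p s"] ge[OF that] by (simp_all add: \<kappa>_def \<kappa>1_def \<kappa>2_def)
    then show "\<kappa> s = 0" if "s \<ge> 1" for s using that by simp
    show "0 \<le> \<kappa> s" "\<kappa> s \<le> 1" for s
      using pos le(1)[of "1 - p s"] by (simp_all add: \<kappa>_def)
    have le': "p1 (1 - p s) \<le> 3" "p2 (1 - p s) \<le> 6" for s
      using le[of "1 - p s"] pos by auto
    show "\<bar>\<kappa>1 s\<bar> \<le> 9" for s
    proof (cases "s \<ge> 1")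
      case False
      then have "p1 (1 - p s) * p1 s \<le> 3 * 3"
        using le[of s] by (intro mult_mono le' pos) auto
      then show ?thesis using pos by (simp add: \<kappa>1_def abs_mult)
    qed (simp add: far)
    show "\<bar>\<kappa>2 s\<bar> \<le> 72" for s
    proof (cases "s \<ge> 1")
      case False
      then have "p2 (1 - p s) * (p1 s)\<^sup>2 \<le> 6 * 3\<^sup>2" "p1 (1 - p s) * p2 s \<le> 3 * 6"
        using le[of s] by (intro mult_mono le' pos power_mono zero_le_power2; simp)+
      moreover have "0 \<le> p2 (1 - p s) * (p1 s)\<^sup>2" "0 \<le> p1 (1 - p s) * p2 s"
        using pos by auto
      ultimately show ?thesis by (simp add: \<kappa>2_def abs_le_iff)
    qed (simp add: far)
  qed
qed

text \<open>The bounds do not depend on \<open>T\<close>: by the product rule, cutting off costs at most the factor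
  \<open>72 + 2 * 9 + 1 = 91\<close>.\<close>

lemma cut_off_profile:
  fixes f f1 f2 :: "real \<Rightarrow> real"
  assumes f: "\<And>t. (f has_real_derivative f1 t) (at t)" "\<And>t. (f1 has_real_derivative f2 t) (at t)"
      "continuous_on UNIV f2"
    and bound: "\<And>t. t > 0 \<Longrightarrow> \<bar>f t\<bar> \<le> K * exp (\<alpha> * t)" "\<And>t. t > 0 \<Longrightarrow> \<bar>f1 t\<bar> \<le> K * exp (\<alpha> * t)"
      "\<And>t. t > 0 \<Longrightarrow> \<bar>f2 t\<bar> \<le> K * exp (\<alpha> * t)"
    and "T > 0"
  obtains g g1 g2 where
    "\<And>t. (g has_real_derivative g1 t) (at t)" "\<And>t. (g1 has_real_derivative g2 t) (at t)"
    "continuous_on UNIV g2" "g 0 = f 0" "g1 0 = f1 0"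
    "\<And>t. t > 0 \<Longrightarrow> \<bar>g t\<bar> \<le> 91 * K * exp (\<alpha> * t)" "\<And>t. t > 0 \<Longrightarrow> \<bar>g2 t\<bar> \<le> 91 * K * exp (\<alpha> * t)"
    "\<And>t. t \<le> T \<Longrightarrow> g t = f t" "\<And>t. t \<ge> T + 1 \<Longrightarrow> g t = 0" "\<And>t. f t \<ge> 0 \<Longrightarrow> g t \<ge> 0"
proof -
  obtain \<kappa> \<kappa>1 \<kappa>2 :: "real \<Rightarrow> real"
  where \<kappa>: "\<And>s. (\<kappa> has_real_derivative \<kappa>1 s) (at s)" "\<And>s. (\<kappa>1 has_real_derivative \<kappa>2 s) (at s)"
    "continuous_on UNIV \<kappa>2"
    "\<And>s. s \<le> 0 \<Longrightarrow> \<kappa> s = 1" "\<And>s. s \<le> 0 \<Longrightarrow> \<kappa>1 s = 0" "\<And>s. s \<ge> 1 \<Longrightarrow> \<kappa> s = 0"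
    "\<And>s. 0 \<le> \<kappa> s" "\<And>s. \<kappa> s \<le> 1" "\<And>s. \<bar>\<kappa>1 s\<bar> \<le> 9" "\<And>s. \<bar>\<kappa>2 s\<bar> \<le> 72"
    using C2_cutoff by blast
  have shift: "((\<lambda>t. h (t - T)) has_real_derivative d) (at t)"
    if "(h has_real_derivative d) (at (t - T))" for h d t
    using DERIV_shift[of h d t "- T"] that by simp
  have c: "continuous_on UNIV f" "continuous_on UNIV f1" "continuous_on UNIV \<kappa>" "continuous_on UNIV \<kappa>1"
    using f(1,2) \<kappa>(1,2) by (auto intro!: continuous_at_imp_continuous_on DERIV_isCont)
  define g where "g t = \<kappa> (t - T) * f t" for t
  define g1 where "g1 t = \<kappa>1 (t - T) * f t + \<kappa> (t - T) * f1 t" for t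
  define g2 where "g2 t = \<kappa>2 (t - T) * f t + 2 * (\<kappa>1 (t - T) * f1 t) + \<kappa> (t - T) * f2 t" for t
  show thesis
  proof (rule that[of g g1 g2])
    show "(g has_real_derivative g1 t) (at t)" for t
      unfolding g_def g1_def
      by (rule DERIV_cong[OF DERIV_mult[OF shift[OF \<kappa>(1)] f(1)]]) simp
    show "(g1 has_real_derivative g2 t) (at t)" for t
      unfolding g1_def g2_def
      by (rule DERIV_cong[OF DERIV_add[OF DERIV_mult[OF shift[OF \<kappa>(2)] f(1)]
            DERIV_mult[OF shift[OF \<kappa>(1)] f(2)]]]) (simp add: algebra_simps)
    show "continuous_on UNIV g2"
      unfolding g2_def
      by (intro continuous_intros c f \<kappa> continuous_on_compose2[OF \<kappa>(3)] continuous_on_compose2[OF c(3)]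
          continuous_on_compose2[OF c(4)]) auto
    show "g 0 = f 0" "g1 0 = f1 0"
      using \<open>T > 0\<close> \<kappa>(4,5) by (simp_all add: g_def g1_def)
    fix t :: real
    show "g t = f t" if "t \<le> T" using that \<kappa>(4) by (simp add: g_def)
    show "g t = 0" if "t \<ge> T + 1" using that \<kappa>(6) by (simp add: g_def)
    show "g t \<ge> 0" if "f t \<ge> 0" using that \<kappa>(7) by (simp add: g_def)
    assume "t > 0"
    define M where "M = K * exp (\<alpha> * t)"
    have M: "\<bar>f t\<bar> \<le> M" "\<bar>f1 t\<bar> \<le> M" "\<bar>f2 t\<bar> \<le> M" "M \<ge> 0"
      using bound[OF \<open>t > 0\<close>] by (auto simp: M_def)
    have "\<bar>\<kappa> (t - T) * f t\<bar> \<le> 1 * M" "\<bar>\<kappa>1 (t - T) * f1 t\<bar> \<le> 9 * M"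
      "\<bar>\<kappa>2 (t - T) * f t\<bar> \<le> 72 * M" "\<bar>\<kappa> (t - T) * f2 t\<bar> \<le> 1 * M"
      using \<kappa>(7,8)[of "t - T"] unfolding abs_mult by (intro mult_mono \<kappa> M; simp)+
    then have "\<bar>g t\<bar> \<le> 91 * M" "\<bar>g2 t\<bar> \<le> 91 * M"
      using M(4) unfolding g_def g2_def by linarith+
    then show "\<bar>g t\<bar> \<le> 91 * K * exp (\<alpha> * t)" "\<bar>g2 t\<bar> \<le> 91 * K * exp (\<alpha> * t)"
      by (simp_all add: M_def)
  qed
qed

section \<open>The forcing term\<close>

lemma integrable_pair_mult:
  fixes h :: "real \<Rightarrow> real" and k :: "'a::euclidean_space \<Rightarrow> real"
  assumes h: "integrable lborel h" and k: "integrable lborel k"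
  shows "integrable (lborel \<Otimes>\<^sub>M lborel) (\<lambda>(t, x). h t * k x)"
proof (rule lborel_pair.Fubini_integrable)
  note [measurable] = borel_measurable_integrable[OF h] borel_measurable_integrable[OF k]
  show "(\<lambda>(t, x). h t * k x) \<in> borel_measurable (lborel \<Otimes>\<^sub>M lborel)"
    by measurable
  show "integrable lborel (\<lambda>t. \<integral>x. norm (case (t, x) of (t, x) \<Rightarrow> h t * k x) \<partial>lborel)"
    using h by (simp add: abs_mult)
  show "AE t in lborel. integrable lborel (\<lambda>x. case (t, x) of (t, x) \<Rightarrow> h t * k x)"
    using k by simp
qed

lemma locally_bounded_imp_measurable:
  assumes "\<And>T. T > 0 \<Longrightarrow> \<eta> \<in> Linf_on {0<..<T}"
  shows "(\<lambda>s. indicator {0<..} s * \<eta> s) \<in> borel_measurable borel"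
proof (rule borel_measurable_LIMSEQ_real)
  show "(\<lambda>s. indicator {0<..<real (Suc n)} s * \<eta> s) \<in> borel_measurable borel" for n
    using assms[of "real (Suc n)"] by (simp add: Linf_on_def set_borel_measurable_def)
  show "(\<lambda>n. indicator {0<..<real (Suc n)} s * \<eta> s) \<longlonglongrightarrow> indicator {0<..} s * \<eta> s" for s
  proof -
    obtain N :: nat where "s < real N" using reals_Archimedean2 by blast
    then have "eventually (\<lambda>n. indicator {0<..} s * \<eta> s = indicator {0<..<real (Suc n)} s * \<eta> s) sequentially"
      by (intro eventually_sequentiallyI[of N]) (auto simp: indicator_def)
    then show ?thesis
      by (rule Lim_transform_eventually[OF tendsto_const])
  qed
qed

lemma locally_bounded_imp_set_integrable:
  assumes "\<eta> \<in> Linf_on {0<..<T}"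
  shows "set_integrable lborel {0<..<T} \<eta>"
proof -
  obtain C where meas: "(\<lambda>s. indicator {0<..<T} s * \<eta> s) \<in> borel_measurable borel"
    and C: "AE s in lborel. s \<in> {0<..<T} \<longrightarrow> \<bar>\<eta> s\<bar> \<le> C"
    using assms by (auto simp: Linf_on_def set_borel_measurable_def)
  have "integrable lborel (\<lambda>s. indicator {0<..<T} s * \<bar>C\<bar>)"
    by (cases "T \<ge> 0") auto
  then have "integrable lborel (\<lambda>s. indicator {0<..<T} s * \<eta> s)"
    by (rule Bochner_Integration.integrable_bound) (use meas C in \<open>auto simp: indicator_def elim!: eventually_mono\<close>)
  then show ?thesis by (simp add: set_integrable_def)
qed

text \<open>The cutoff of \<open>c\<close> at \<open>S\<close> confines the argument of \<open>\<eta>\<close> to the interval \<open>(0, \<epsilon> S)\<close>,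
  where \<open>\<eta>\<close> is bounded.\<close>

lemma integrable_forcing_weight:
  assumes "\<epsilon> > 0" "S > 0" and \<eta>: "\<eta> \<in> Linf_on {0<..<\<epsilon> * S}"
    and c: "c \<in> borel_measurable borel" "\<And>t. t > 0 \<Longrightarrow> \<bar>c t\<bar> \<le> M" "\<And>t. t \<ge> S \<Longrightarrow> c t = 0"
  shows "integrable lborel (\<lambda>t. indicator {0<..} t * (\<eta> (\<epsilon> * t) * c t))"
proof -
  have "integrable lborel (\<lambda>s. indicator {0<..<\<epsilon> * S} s * \<eta> s)"
    using locally_bounded_imp_set_integrable[OF \<eta>] by (simp add: set_integrable_def)
  from lborel_integrable_real_affine[OF this, of \<epsilon> 0] \<open>\<epsilon> > 0\<close>
  have i: "integrable lborel (\<lambda>t. M * (indicator {0<..<\<epsilon> * S} (\<epsilon> * t) * \<eta> (\<epsilon> * t)))"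
    and meas [measurable]: "(\<lambda>t. indicator {0<..<\<epsilon> * S} (\<epsilon> * t) * \<eta> (\<epsilon> * t)) \<in> borel_measurable borel"
    by auto
  note [measurable] = c(1)
  have "integrable lborel (\<lambda>t. (indicator {0<..<\<epsilon> * S} (\<epsilon> * t) * \<eta> (\<epsilon> * t)) * c t)"
  proof (rule Bochner_Integration.integrable_bound[OF i], use meas in measurable, rule AE_I2)
    fix t
    show "norm (indicator {0<..<\<epsilon> * S} (\<epsilon> * t) * \<eta> (\<epsilon> * t) * c t)
        \<le> norm (M * (indicator {0<..<\<epsilon> * S} (\<epsilon> * t) * \<eta> (\<epsilon> * t)))"
    proof (cases "t > 0")
      case True
      then show ?thesis
        using c(2)[OF True] mult_right_mono[of "\<bar>c t\<bar>" "\<bar>M\<bar>" "\<bar>\<eta> (\<epsilon> * t)\<bar>"]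
        by (auto simp: abs_mult indicator_def mult.commute)
    qed (use \<open>\<epsilon> > 0\<close> in \<open>auto simp: indicator_def zero_less_mult_iff\<close>)
  qed
  also have "(\<lambda>t. (indicator {0<..<\<epsilon> * S} (\<epsilon> * t) * \<eta> (\<epsilon> * t)) * c t)
      = (\<lambda>t. indicator {0<..} t * (\<eta> (\<epsilon> * t) * c t))"
    using c(3) \<open>\<epsilon> > 0\<close> by (auto simp: indicator_def fun_eq_iff zero_less_mult_iff not_less)
  finally show ?thesis .
qed

lemma AE_nonneg_rescaled:
  assumes "\<epsilon> > 0"
    and \<eta>: "\<And>T. T > 0 \<Longrightarrow> \<eta> \<in> Linf_on {0<..<T}"
    and nonneg: "AE s in lborel. s > 0 \<longrightarrow> \<eta> s \<ge> 0"
  shows "AE t in lborel. t > 0 \<longrightarrow> \<eta> (\<epsilon> * t) \<ge> 0"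
proof -
  note [measurable] = locally_bounded_imp_measurable[OF \<eta>]
  have "AE s in lborel. 0 \<le> indicator {0<..} s * \<eta> s"
    using nonneg by eventually_elim (auto simp: indicator_def)
  then have "AE t in lborel. 0 \<le> indicator {0<..} (0 + \<epsilon> * t) * \<eta> (0 + \<epsilon> * t)"
    using \<open>\<epsilon> > 0\<close> by (intro AE_borel_affine[where P = "\<lambda>s. 0 \<le> indicator {0<..} s * \<eta> s"]) measurable
  then show ?thesis
    by eventually_elim (use \<open>\<epsilon> > 0\<close> in \<open>auto simp: indicator_def zero_less_mult_iff\<close>)
qed

text \<open>The substitution \<open>s = \<epsilon> t\<close> turns the Laplace integral with \<open>\<delta> = \<epsilon> / \<beta>\<close> into the integral of
  \<open>exp (- \<beta> t) \<eta> (\<epsilon> t)\<close>, and by monotone convergence its truncations exceed every bound.\<close>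

lemma forcing_work_unbounded:
  assumes "\<epsilon> > 0" "\<beta> > 0"
    and \<eta>: "\<And>T. T > 0 \<Longrightarrow> \<eta> \<in> Linf_on {0<..<T}"
    and nonneg: "AE s in lborel. s > 0 \<longrightarrow> \<eta> s \<ge> 0"
    and div: "(\<integral>\<^sup>+s\<in>{0<..}. ennreal (exp (- s / (\<epsilon> / \<beta>)) * \<eta> s) \<partial>lborel) = \<infinity>"
  obtains T where "T > 0"
    "L \<le> (\<integral>t. indicator {0<..} t * (\<eta> (\<epsilon> * t) * (indicator {..<T} t * exp (- \<beta> * t))) \<partial>lborel)"
proof -
  note [measurable] = locally_bounded_imp_measurable[OF \<eta>]
  have pos: "AE t in lborel. t > 0 \<longrightarrow> \<eta> (\<epsilon> * t) \<ge> 0"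
    by (rule AE_nonneg_rescaled[OF \<open>\<epsilon> > 0\<close> \<eta> nonneg])
  define G where "G t = ennreal (indicator {0<..} t * (exp (- \<beta> * t) * \<eta> (\<epsilon> * t)))" for t
  have meas: "(\<lambda>t. indicator {0<..} t * \<eta> (\<epsilon> * t)) \<in> borel_measurable borel"
  proof -
    have "(\<lambda>t. indicator {0<..} (\<epsilon> * t) * \<eta> (\<epsilon> * t)) \<in> borel_measurable borel"
      using measurable_compose[OF _ locally_bounded_imp_measurable[OF \<eta>], of "\<lambda>t. \<epsilon> * t" borel] by simp
    also have "(\<lambda>t. indicator {0<..} (\<epsilon> * t) * \<eta> (\<epsilon> * t)) = (\<lambda>t. indicator {0<..} t * \<eta> (\<epsilon> * t))"
      using \<open>\<epsilon> > 0\<close> by (auto simp: indicator_def fun_eq_iff zero_less_mult_iff)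
    finally show ?thesis .
  qed
  have G[measurable]: "G \<in> borel_measurable borel"
  proof -
    have "(\<lambda>t. ennreal (exp (- \<beta> * t) * (indicator {0<..} t * \<eta> (\<epsilon> * t)))) \<in> borel_measurable borel"
      using meas by measurable
    then show ?thesis by (simp add: G_def[abs_def] mult.left_commute)
  qed
  have "\<infinity> = (\<integral>\<^sup>+s. ennreal (exp (- s * \<beta> / \<epsilon>) * (indicator {0<..} s * \<eta> s)) \<partial>lborel)"
    unfolding div[unfolded infinity_ennreal_def, symmetric] infinity_ennreal_def
    by (rule nn_integral_cong) (auto simp: indicator_def)
  also have "\<dots> = \<bar>\<epsilon>\<bar> * (\<integral>\<^sup>+t. ennreal (exp (- (0 + \<epsilon> * t) * \<beta> / \<epsilon>) *
      (indicator {0<..} (0 + \<epsilon> * t) * \<eta> (0 + \<epsilon> * t))) \<partial>lborel)"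
    using \<open>\<epsilon> > 0\<close> by (intro nn_integral_real_affine) auto
  also have "(\<integral>\<^sup>+t. ennreal (exp (- (0 + \<epsilon> * t) * \<beta> / \<epsilon>) *
      (indicator {0<..} (0 + \<epsilon> * t) * \<eta> (0 + \<epsilon> * t))) \<partial>lborel) = (\<integral>\<^sup>+t. G t \<partial>lborel)"
    using \<open>\<epsilon> > 0\<close>
    by (intro nn_integral_cong) (auto simp: G_def indicator_def zero_less_mult_iff mult.commute)
  finally have "(\<integral>\<^sup>+t. G t \<partial>lborel) = \<infinity>"
    by (metis ennreal_mult_eq_top_iff ennreal_neq_top infinity_ennreal_def)
  moreover have "(\<integral>\<^sup>+t. G t \<partial>lborel) = (SUP n. \<integral>\<^sup>+t. G t * indicator {..<real n} t \<partial>lborel)"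
  proof -
    have "G t = (SUP n. G t * indicator {..<real n} t)" for t
    proof -
      obtain n :: nat where "t < real n" using reals_Archimedean2 by blast
      then have "G t = G t * indicator {..<real n} t" by simp
      then have "G t \<le> (SUP n. G t * indicator {..<real n} t)"
        by (metis SUP_upper UNIV_I)
      moreover have "(SUP n. G t * indicator {..<real n} t) \<le> G t"
        by (rule SUP_least) (auto simp: indicator_def)
      ultimately show ?thesis by simp
    qed
    then have "(\<integral>\<^sup>+t. G t \<partial>lborel) = (\<integral>\<^sup>+t. (SUP n. G t * indicator {..<real n} t) \<partial>lborel)"
      by simp
    also have "\<dots> = (SUP n. \<integral>\<^sup>+t. G t * indicator {..<real n} t \<partial>lborel)"
      by (rule nn_integral_monotone_convergence_SUP)
         (auto simp: incseq_def le_fun_def indicator_def)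
    finally show ?thesis .
  qed
  ultimately have "(SUP n. \<integral>\<^sup>+t. G t * indicator {..<real n} t \<partial>lborel) = \<infinity>"
    by (simp only:)
  then have "ennreal \<bar>L\<bar> < (SUP n. \<integral>\<^sup>+t. G t * indicator {..<real n} t \<partial>lborel)"
    by (simp only: infinity_ennreal_def ennreal_less_top)
  then obtain n where "ennreal \<bar>L\<bar> < (\<integral>\<^sup>+t. G t * indicator {..<real n} t \<partial>lborel)"
    by (auto simp: less_SUP_iff)
  also have "\<dots> \<le> (\<integral>\<^sup>+t. G t * indicator {..<real (Suc n)} t \<partial>lborel)"
    by (intro nn_integral_mono) (auto simp: indicator_def)
  finally have n: "ennreal \<bar>L\<bar> < (\<integral>\<^sup>+t. G t * indicator {..<real (Suc n)} t \<partial>lborel)" .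
  define h where "h t = indicator {0<..} t * (\<eta> (\<epsilon> * t) * (indicator {..<real (Suc n)} t * exp (- \<beta> * t)))" for t
  have "integrable lborel h"
    unfolding h_def
  proof (rule integrable_forcing_weight[where M = 1 and S = "real (Suc n)"])
    show "\<bar>indicator {..<real (Suc n)} t * exp (- \<beta> * t)\<bar> \<le> 1" if "t > 0" for t
      using that \<open>\<beta> > 0\<close> by (auto simp: indicator_def)
  qed (use \<open>\<epsilon> > 0\<close> \<eta> in auto)
  moreover have "AE t in lborel. 0 \<le> h t"
    using pos by eventually_elim (auto simp: h_def indicator_def)
  ultimately have "(\<integral>\<^sup>+t. ennreal (h t) \<partial>lborel) = ennreal (\<integral>t. h t \<partial>lborel)"
    by (rule nn_integral_eq_integral)
  also have "(\<integral>\<^sup>+t. ennreal (h t) \<partial>lborel) = (\<integral>\<^sup>+t. G t * indicator {..<real (Suc n)} t \<partial>lborel)"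
    by (intro nn_integral_cong) (auto simp: h_def G_def indicator_def mult.commute)
  finally have "ennreal \<bar>L\<bar> < ennreal (\<integral>t. h t \<partial>lborel)"
    using n by simp
  then have "\<bar>L\<bar> < (\<integral>t. h t \<partial>lborel)"
    by (simp add: ennreal_less_iff)
  then have "L \<le> (\<integral>t. h t \<partial>lborel)" by linarith
  then show thesis
    unfolding h_def by (intro that[of "real (Suc n)"]) simp_all
qed

lemma two_mode_forcing:
  fixes \<phi> w0 w1 :: "'a::euclidean_space \<Rightarrow> real"
  assumes F: "\<And>t x v. t > 0 \<Longrightarrow> F t x v = \<eta> t * \<phi> x * v" and "\<epsilon> > 0"
    and L2: "\<phi> \<in> Lp_space 2" "w0 \<in> Lp_space 2" "w1 \<in> Lp_space 2"
    and a: "integrable lborel (\<lambda>t. indicator {0<..} t * (\<eta> (\<epsilon> * t) * (exp (- t) * a t)))"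
    and b: "integrable lborel (\<lambda>t. indicator {0<..} t * (\<eta> (\<epsilon> * t) * (exp (- t) * b t)))"
  shows "Phi_abs_convergent \<epsilon> F (two_mode a b w0 w1)"
    and "Phi \<epsilon> F (two_mode a b w0 w1) = (\<integral>t. indicator {0<..} t * (\<eta> (\<epsilon> * t) *
      (exp (- t) * (a t * (\<integral>x. \<phi> x * w0 x \<partial>lborel) + b t * (\<integral>x. \<phi> x * w1 x \<partial>lborel)))) \<partial>lborel)"
proof -
  have i: "integrable lborel (\<lambda>x. \<phi> x * w0 x)" "integrable lborel (\<lambda>x. \<phi> x * w1 x)"
    by (intro L2_mult_integrable L2)+
  have "integrable (lborel \<Otimes>\<^sub>M lborel) (\<lambda>p.
      (case p of (t, x) \<Rightarrow> (indicator {0<..} t * (\<eta> (\<epsilon> * t) * (exp (- t) * a t))) * (\<phi> x * w0 x)) +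
      (case p of (t, x) \<Rightarrow> (indicator {0<..} t * (\<eta> (\<epsilon> * t) * (exp (- t) * b t))) * (\<phi> x * w1 x)))"
    by (intro Bochner_Integration.integrable_add integrable_pair_mult a b i)
  also have "(\<lambda>p.
      (case p of (t, x) \<Rightarrow> (indicator {0<..} t * (\<eta> (\<epsilon> * t) * (exp (- t) * a t))) * (\<phi> x * w0 x)) +
      (case p of (t, x) \<Rightarrow> (indicator {0<..} t * (\<eta> (\<epsilon> * t) * (exp (- t) * b t))) * (\<phi> x * w1 x)))
    = (\<lambda>p. indicator ({0<..} \<times> UNIV) p *\<^sub>R (case p of (t, x) \<Rightarrow> exp (- t) * F (\<epsilon> * t) x (two_mode a b w0 w1 t x)))"
    using F \<open>\<epsilon> > 0\<close> by (auto simp: fun_eq_iff indicator_def two_mode_def algebra_simps)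
  finally show "Phi_abs_convergent \<epsilon> F (two_mode a b w0 w1)"
    by (simp add: Phi_abs_convergent_def set_integrable_def)
  have "(\<integral>x. F (\<epsilon> * t) x (two_mode a b w0 w1 t x) \<partial>lborel)
      = \<eta> (\<epsilon> * t) * (a t * (\<integral>x. \<phi> x * w0 x \<partial>lborel) + b t * (\<integral>x. \<phi> x * w1 x \<partial>lborel))" if "t > 0" for t
  proof -
    have "(\<integral>x. F (\<epsilon> * t) x (two_mode a b w0 w1 t x) \<partial>lborel)
        = (\<integral>x. \<eta> (\<epsilon> * t) * (a t * (\<phi> x * w0 x) + b t * (\<phi> x * w1 x)) \<partial>lborel)"
      using F that \<open>\<epsilon> > 0\<close> by (intro Bochner_Integration.integral_cong) (auto simp: two_mode_def algebra_simps)
    then show ?thesis using i by simp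
  qed
  then show "Phi \<epsilon> F (two_mode a b w0 w1) = (\<integral>t. indicator {0<..} t * (\<eta> (\<epsilon> * t) *
      (exp (- t) * (a t * (\<integral>x. \<phi> x * w0 x \<partial>lborel) + b t * (\<integral>x. \<phi> x * w1 x \<partial>lborel)))) \<partial>lborel)"
    unfolding Phi_def set_lebesgue_integral_def
    by (intro Bochner_Integration.integral_cong) (auto simp: indicator_def)
qed

section \<open>Unboundedness from below\<close>

theorem proposition4p6:
  fixes r \<epsilon> :: real
    and \<eta> :: "real \<Rightarrow> real"
    and \<phi> w0 w1 :: "real ^ 'n \<Rightarrow> real"
    and F :: "real \<Rightarrow> real ^ 'n \<Rightarrow> real \<Rightarrow> real"
  assumes "r > 1"
    and "\<epsilon> > 0"
    and "\<And>t x v. t > 0 \<Longrightarrow> F t x v = \<eta> t * \<phi> x * v"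
    and "\<phi> \<in> Lp_space 2"
    and "AE x in lborel. \<phi> x \<ge> 0"
    and "\<eta> \<in> L1_loc_pos"
    and "AE t in lborel. t > 0 \<longrightarrow> \<eta> t \<ge> 0"
    and "\<And>T. T > 0 \<Longrightarrow> \<eta> \<in> Linf_on {0<..<T}"
    and "w1 \<in> H_space r"
    and "AE x in lborel. w1 x \<ge> 0"
    and "w0 \<in> H_space r"
    and "(\<integral>x. \<phi> x * w0 x \<partial>lborel) > 0"
    and "\<And>\<delta>. \<delta> > 0 \<Longrightarrow> (\<integral>\<^sup>+t\<in>{0<..}. ennreal (exp (- t / \<delta>) * \<eta> t) \<partial>lborel) = \<infinity>"
  shows "\<forall>M>0. \<exists>u\<in>U0_space \<epsilon> w0 w1. Phi_abs_convergent \<epsilon> F u \<and> J r \<epsilon> F u < ereal (- M)"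
proof (intro allI impI)
  fix M :: real assume "M > 0"
  define A where "A = (\<integral>x. \<phi> x * w0 x \<partial>lborel)"
  define B where "B = (\<integral>x. \<phi> x * w1 x \<partial>lborel)"
  have "A > 0" using assms(12) by (simp add: A_def)
  have "B \<ge> 0"
    unfolding B_def by (rule integral_nonneg_AE) (use assms(5,10) in eventually_elim, simp)
  \<comment> \<open>The exponent is small enough for the energy and positive, so that the forcing sees growth.\<close>
  define \<alpha> where "\<alpha> = 1 / (max 2 r + 1)"
  have \<alpha>: "\<alpha> > 0" "\<alpha> < 1" "max 2 r * \<alpha> < 1"
    by (auto simp: \<alpha>_def field_simps)
  \<comment> \<open>One constant for both uncut profiles: \<open>\<epsilon> t = (\<epsilon> / \<alpha>) (\<alpha> t)\<close> is at most \<open>(\<epsilon> / \<alpha>) exp (\<alpha> t)\<close>.\<close>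
  define K where "K = 1 + \<epsilon> + \<epsilon> / \<alpha>"
  have K: "K \<ge> 1" "K \<ge> \<epsilon>" "K \<ge> \<epsilon> / \<alpha>"
    using \<open>\<epsilon> > 0\<close> \<alpha> by (auto simp: K_def)
  have L2: "w0 \<in> Lp_space 2" "w1 \<in> Lp_space 2"
    using assms(9,11) by (auto simp: H_space_def H1_space_def)
  \<comment> \<open>The energy bound is fixed first; only then is \<open>T\<close> chosen so that the forcing beats it.\<close>
  obtain C where "C \<ge> 0"
    and energy: "\<And>a b a2 b2. (\<And>t. t > 0 \<Longrightarrow> \<bar>a t\<bar> \<le> (91 * K) * exp (\<alpha> * t) \<and> \<bar>b t\<bar> \<le> (91 * K) * exp (\<alpha> * t) \<and>
          \<bar>a2 t\<bar> \<le> (91 * K) * exp (\<alpha> * t) \<and> \<bar>b2 t\<bar> \<le> (91 * K) * exp (\<alpha> * t)) \<Longrightarrow>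
      (\<integral>\<^sup>+t\<in>{0<..}. ennreal (exp (- t)) * (ennreal (1 / (2 * \<epsilon>\<^sup>2) *
        (Lp_norm 2 (two_mode a2 b2 w0 w1 t))\<^sup>2) + W r (two_mode a b w0 w1 t)) \<partial>lborel) \<le> ennreal C \<and>
      (\<integral>\<^sup>+t\<in>{0<..}. ennreal (exp (- t) * (Lp_norm 2 (two_mode a2 b2 w0 w1 t))\<^sup>2) \<partial>lborel) \<le> ennreal C"
    by (rule two_mode_energy_bound[OF \<open>r > 1\<close> assms(11,9) _ \<alpha>(1,3), of "91 * K" \<epsilon>]) (use K in auto)
  define I where "I T = (\<integral>t. indicator {0<..} t * (\<eta> (\<epsilon> * t) * (indicator {..<T} t * exp (- (1 - \<alpha>) * t))) \<partial>lborel)" for T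
  have div: "(\<integral>\<^sup>+t\<in>{0<..}. ennreal (exp (- t / (\<epsilon> / (1 - \<alpha>))) * \<eta> t) \<partial>lborel) = \<infinity>"
    using assms(2) \<alpha> by (intro assms(13)) simp
  have "1 - \<alpha> > 0" using \<alpha> by simp
  obtain T where "T > 0" and T: "2 * (C + M + 1) / A \<le> I T"
    by (rule forcing_work_unbounded[OF assms(2) \<open>1 - \<alpha> > 0\<close> assms(8,7) div, where L = "2 * (C + M + 1) / A"])
       (auto simp: I_def intro: that)
  have \<eta>_nonneg: "AE t in lborel. t > 0 \<longrightarrow> \<eta> (\<epsilon> * t) \<ge> 0"
    by (rule AE_nonneg_rescaled[OF assms(2,8,7)])
  have exp1: "1 \<le> exp (\<alpha> * t)" if "t > 0" for t
    using that \<alpha> by simp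
  have cosh: "\<bar>cosh (\<alpha> * t)\<bar> \<le> exp (\<alpha> * t)" "\<bar>sinh (\<alpha> * t)\<bar> \<le> exp (\<alpha> * t)" if "t > 0" for t
  proof -
    have half: "\<bar>(p + q) / 2\<bar> \<le> p" "\<bar>(p - q) / 2\<bar> \<le> p" if "0 < p" "0 < q" "q \<le> p" for p q :: real
      using that by (simp_all add: abs_le_iff)
    have "exp (- (\<alpha> * t)) \<le> exp (\<alpha> * t)"
      using that \<alpha> by simp
    from half[OF exp_gt_zero exp_gt_zero this]
    show "\<bar>cosh (\<alpha> * t)\<bar> \<le> exp (\<alpha> * t)" "\<bar>sinh (\<alpha> * t)\<bar> \<le> exp (\<alpha> * t)"
      unfolding cosh_field_def sinh_field_def by blast+
  qed
  have Kexp: "exp (\<alpha> * t) \<le> K * exp (\<alpha> * t)" for t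
    using K(1) by simp
  \<comment> \<open>Unlike \<open>exp (\<alpha> t)\<close>, the hyperbolic cosine has slope 0 at the origin, as the initial velocity demands,
    and it still dominates \<open>exp (\<alpha> t) / 2\<close>.\<close>
  obtain a a1 a2 where a:
    "\<And>t. (a has_real_derivative a1 t) (at t)" "\<And>t. (a1 has_real_derivative a2 t) (at t)"
    "continuous_on UNIV a2" "a 0 = cosh (\<alpha> * 0)" "a1 0 = \<alpha> * sinh (\<alpha> * 0)"
    "\<And>t. t > 0 \<Longrightarrow> \<bar>a t\<bar> \<le> 91 * K * exp (\<alpha> * t)" "\<And>t. t > 0 \<Longrightarrow> \<bar>a2 t\<bar> \<le> 91 * K * exp (\<alpha> * t)"
    "\<And>t. t \<le> T \<Longrightarrow> a t = cosh (\<alpha> * t)" "\<And>t. t \<ge> T + 1 \<Longrightarrow> a t = 0" "\<And>t. cosh (\<alpha> * t) \<ge> 0 \<Longrightarrow> a t \<ge> 0"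
  proof (rule cut_off_profile[of "\<lambda>t. cosh (\<alpha> * t)" "\<lambda>t. \<alpha> * sinh (\<alpha> * t)" "\<lambda>t. \<alpha> * (\<alpha> * cosh (\<alpha> * t))" K \<alpha> T])
    fix t :: real
    show "((\<lambda>t. cosh (\<alpha> * t)) has_real_derivative \<alpha> * sinh (\<alpha> * t)) (at t)"
      "((\<lambda>t. \<alpha> * sinh (\<alpha> * t)) has_real_derivative \<alpha> * (\<alpha> * cosh (\<alpha> * t))) (at t)"
      by (auto intro!: derivative_eq_intros)
    show "continuous_on UNIV (\<lambda>t. \<alpha> * (\<alpha> * cosh (\<alpha> * t)))"
      by (intro continuous_intros)
    assume "t > 0"
    have "\<bar>\<alpha> * sinh (\<alpha> * t)\<bar> \<le> 1 * exp (\<alpha> * t)" "\<bar>\<alpha> * (\<alpha> * cosh (\<alpha> * t))\<bar> \<le> 1 * (1 * exp (\<alpha> * t))"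
      unfolding abs_mult using \<alpha> cosh[OF \<open>t > 0\<close>] by (intro mult_mono; simp)+
    with cosh[OF \<open>t > 0\<close>] Kexp[of t] show "\<bar>cosh (\<alpha> * t)\<bar> \<le> K * exp (\<alpha> * t)"
      "\<bar>\<alpha> * sinh (\<alpha> * t)\<bar> \<le> K * exp (\<alpha> * t)" "\<bar>\<alpha> * (\<alpha> * cosh (\<alpha> * t))\<bar> \<le> K * exp (\<alpha> * t)"
      by linarith+
  qed (use \<open>T > 0\<close> in auto)
  obtain b b1 b2 where b:
    "\<And>t. (b has_real_derivative b1 t) (at t)" "\<And>t. (b1 has_real_derivative b2 t) (at t)"
    "continuous_on UNIV b2" "b 0 = \<epsilon> * 0" "b1 0 = \<epsilon>"
    "\<And>t. t > 0 \<Longrightarrow> \<bar>b t\<bar> \<le> 91 * K * exp (\<alpha> * t)" "\<And>t. t > 0 \<Longrightarrow> \<bar>b2 t\<bar> \<le> 91 * K * exp (\<alpha> * t)"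
    "\<And>t. t \<le> T \<Longrightarrow> b t = \<epsilon> * t" "\<And>t. t \<ge> T + 1 \<Longrightarrow> b t = 0" "\<And>t. \<epsilon> * t \<ge> 0 \<Longrightarrow> b t \<ge> 0"
  proof (rule cut_off_profile[of "\<lambda>t. \<epsilon> * t" "\<lambda>t. \<epsilon>" "\<lambda>t. 0" K \<alpha> T])
    fix t :: real
    show "((\<lambda>t. \<epsilon> * t) has_real_derivative \<epsilon>) (at t)"
      by (auto intro!: derivative_eq_intros)
    assume "t > 0"
    have "\<alpha> * t \<le> exp (\<alpha> * t)"
      using exp_ge_add_one_self[of "\<alpha> * t"] by linarith
    have "\<epsilon> * t = \<epsilon> / \<alpha> * (\<alpha> * t)" using \<alpha> by simp
    also have "\<dots> \<le> K * exp (\<alpha> * t)"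
      using K(1,3) \<alpha> \<open>t > 0\<close> \<open>\<alpha> * t \<le> exp (\<alpha> * t)\<close> by (intro mult_mono) auto
    finally show "\<bar>\<epsilon> * t\<bar> \<le> K * exp (\<alpha> * t)"
      using \<open>\<epsilon> > 0\<close> \<open>t > 0\<close> by simp
    show "\<bar>\<epsilon>\<bar> \<le> K * exp (\<alpha> * t)"
      using mult_mono[OF K(2) exp1[OF \<open>t > 0\<close>]] K(1) \<open>\<epsilon> > 0\<close> by simp
    show "\<bar>0\<bar> \<le> K * exp (\<alpha> * t)"
      using K(1) by simp
  qed (use \<open>T > 0\<close> in auto)
  define u where "u = two_mode a b w0 w1"
  note en = energy[of a b a2 b2, OF conjI[OF a(6) conjI[OF b(6) conjI[OF a(7) b(7)]]]]
  have "(\<integral>\<^sup>+t\<in>{0<..}. ennreal (exp (- t) * (Lp_norm 2 (two_mode a2 b2 w0 w1 t))\<^sup>2) \<partial>lborel) < \<infinity>"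
    using en by (auto intro: le_less_trans[of _ "ennreal C"])
  then have U0: "u \<in> U0_space \<epsilon> w0 w1"
    and eq: "AE t in lborel. t > 0 \<longrightarrow> Lp_norm 2 (time_deriv (time_deriv u) t) = Lp_norm 2 (two_mode a2 b2 w0 w1 t)"
    using two_mode_in_U0_space[OF L2 a(1-3) _ _ b(1-3), of \<epsilon>] a(4,5) b(4,5) by (simp_all add: u_def)
  have cont: "a \<in> borel_measurable borel" "b \<in> borel_measurable borel"
    using a(1) b(1) by (auto intro!: borel_measurable_continuous_onI continuous_at_imp_continuous_on DERIV_isCont)
  have weight: "integrable lborel (\<lambda>t. indicator {0<..} t * (\<eta> (\<epsilon> * t) * (exp (- t) * c t)))"
    if "c \<in> borel_measurable borel" "\<And>t. t > 0 \<Longrightarrow> \<bar>c t\<bar> \<le> 91 * K * exp (\<alpha> * t)"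
      "\<And>t. t \<ge> T + 1 \<Longrightarrow> c t = 0" for c
  proof (rule integrable_forcing_weight[OF \<open>\<epsilon> > 0\<close>, where S = "T + 1" and M = "91 * K"])
    note [measurable] = that(1)
    show "(\<lambda>t. exp (- t) * c t) \<in> borel_measurable borel" by measurable
    fix t :: real assume "t > 0"
    have "\<bar>exp (- t) * c t\<bar> \<le> exp (- t) * (91 * K * exp (\<alpha> * t))"
      unfolding abs_mult using that(2)[OF \<open>t > 0\<close>] by simp
    also have "\<dots> = 91 * K * exp (- ((1 - \<alpha>) * t))"
      by (simp add: exp_add[symmetric] algebra_simps)
    also have "\<dots> \<le> 91 * K"
      using \<alpha> K \<open>t > 0\<close> by simp
    finally show "\<bar>exp (- t) * c t\<bar> \<le> 91 * K" .
  qed (use that \<open>T > 0\<close> \<open>\<epsilon> > 0\<close> assms(8) in auto)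
  note wa = weight[OF cont(1) a(6) a(9)] and wb = weight[OF cont(2) b(6) b(9)]
  note forcing = two_mode_forcing[OF assms(3,2,4) L2 wa wb]
  have "C + M + 1 \<le> Phi \<epsilon> F u"
  proof -
    have "C + M + 1 \<le> A / 2 * I T"
      using T \<open>A > 0\<close> by (simp add: field_simps)
    also have "\<dots> = (\<integral>t. A / 2 * (indicator {0<..} t * (\<eta> (\<epsilon> * t) * (indicator {..<T} t * exp (- (1 - \<alpha>) * t)))) \<partial>lborel)"
      by (simp add: I_def)
    also have "\<dots> \<le> (\<integral>t. indicator {0<..} t * (\<eta> (\<epsilon> * t) * (exp (- t) * (a t * A + b t * B))) \<partial>lborel)"
    proof (rule integral_mono_AE)
      have "integrable lborel (\<lambda>t. indicator {0<..} t * (\<eta> (\<epsilon> * t) * (indicator {..<T} t * exp (- (1 - \<alpha>) * t))))"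
        by (rule integrable_forcing_weight[OF \<open>\<epsilon> > 0\<close> \<open>T > 0\<close>, where M = 1])
           (use assms(8) \<open>T > 0\<close> \<open>\<epsilon> > 0\<close> \<alpha> in \<open>auto simp: indicator_def mult_nonpos_nonneg\<close>)
      then show "integrable lborel (\<lambda>t. A / 2 * (indicator {0<..} t * (\<eta> (\<epsilon> * t) * (indicator {..<T} t * exp (- (1 - \<alpha>) * t)))))"
        by simp
      have "integrable lborel (\<lambda>t. indicator {0<..} t * (\<eta> (\<epsilon> * t) * (exp (- t) * a t)) * A
          + indicator {0<..} t * (\<eta> (\<epsilon> * t) * (exp (- t) * b t)) * B)"
        using wa wb by simp
      then show "integrable lborel (\<lambda>t. indicator {0<..} t * (\<eta> (\<epsilon> * t) * (exp (- t) * (a t * A + b t * B))))"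
        by (simp add: algebra_simps)
      show "AE t in lborel. A / 2 * (indicator {0<..} t * (\<eta> (\<epsilon> * t) * (indicator {..<T} t * exp (- (1 - \<alpha>) * t))))
          \<le> indicator {0<..} t * (\<eta> (\<epsilon> * t) * (exp (- t) * (a t * A + b t * B)))"
        using \<eta>_nonneg
      proof eventually_elim
        case (elim t)
        show ?case
        proof (cases "t > 0")
          case True
          \<comment> \<open>After \<open>T\<close> only the sign of \<open>a\<close> is needed, as the indicator vanishes there.\<close>
          have "indicator {..<T} t * exp (\<alpha> * t) \<le> 2 * a t"
          proof (cases "t < T")
            case True
            then have "2 * a t = exp (\<alpha> * t) + exp (- (\<alpha> * t))"
              using a(8)[of t] by (simp add: cosh_field_def)
            then have "exp (\<alpha> * t) \<le> 2 * a t"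
              using exp_gt_zero[of "- (\<alpha> * t)"] by linarith
            with True show ?thesis by simp
          qed (use a(10)[of t] in simp)
          then have "indicator {..<T} t * exp (\<alpha> * t) * A \<le> 2 * a t * A"
            using \<open>A > 0\<close> by (intro mult_right_mono) auto
          moreover have "0 \<le> b t * B"
            using b(10)[of t] True \<open>\<epsilon> > 0\<close> \<open>B \<ge> 0\<close> by simp
          ultimately have "A / 2 * (indicator {..<T} t * exp (\<alpha> * t)) \<le> a t * A + b t * B"
            by (simp add: mult.commute)
          then have "(\<eta> (\<epsilon> * t) * exp (- t)) * (A / 2 * (indicator {..<T} t * exp (\<alpha> * t)))
              \<le> (\<eta> (\<epsilon> * t) * exp (- t)) * (a t * A + b t * B)"
            using elim True by (intro mult_left_mono) auto
          moreover have "exp (- (1 - \<alpha>) * t) = exp (- t) * exp (\<alpha> * t)"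
            by (simp add: exp_add[symmetric] algebra_simps)
          ultimately show ?thesis
            using True by (simp add: mult_ac)
        qed simp
      qed
    qed
    also have "\<dots> = Phi \<epsilon> F u"
      using forcing(2) by (simp add: u_def A_def B_def)
    finally show ?thesis .
  qed
  have "(\<integral>\<^sup>+t\<in>{0<..}. ennreal (exp (- t)) * (ennreal (1 / (2 * \<epsilon>\<^sup>2) *
        (Lp_norm 2 (time_deriv (time_deriv u) t))\<^sup>2) + W r (u t)) \<partial>lborel)
      = (\<integral>\<^sup>+t\<in>{0<..}. ennreal (exp (- t)) * (ennreal (1 / (2 * \<epsilon>\<^sup>2) *
        (Lp_norm 2 (two_mode a2 b2 w0 w1 t))\<^sup>2) + W r (u t)) \<partial>lborel)"
    by (rule nn_integral_cong_AE) (use eq in \<open>auto simp: indicator_def elim!: eventually_mono\<close>)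
  also have "\<dots> \<le> ennreal C"
    using en by (simp add: u_def)
  finally have "J r \<epsilon> F u \<le> ereal C - ereal (Phi \<epsilon> F u)"
    unfolding J_def
    using \<open>C \<ge> 0\<close> by (intro ereal_minus_mono) (auto simp: less_eq_ennreal.rep_eq)
  also have "\<dots> < ereal (- M)"
    using \<open>C + M + 1 \<le> Phi \<epsilon> F u\<close> by simp
  finally have "J r \<epsilon> F u < ereal (- M)" .
  then show "\<exists>u\<in>U0_space \<epsilon> w0 w1. Phi_abs_convergent \<epsilon> F u \<and> J r \<epsilon> F u < ereal (- M)"
    using U0 forcing(1) unfolding u_def by blast
qed

end
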